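(* Let $\{X(t),t>0\}$ be a circularly symmetric Gaussian multicomponent locally self-similar process, i.e. with covariance $$R_X(t,s)=E(X(t)X^*(s))=\sum_{j=1}^\infty Q_j(\sqrt{ts})\,C_{X_j}(t/s),\qquad t,s>0,$$ where each term $Q_j(\sqrt{ts})\,C_{X_j}(t/s)$ is the covariance function of a locally self-similar process. Then the optimal ambiguity-domain kernel of $X$ is given, for all $(\theta,\tau)\in\mathbb{R}\times\mathbb{R}^+$ with $E|A_X(\theta,\tau)|^2>0$, by $$\phi(\theta,\tau)=\frac{\big|\sum_{j=1}^\infty C_{X_j}(\tau)\,(\mathcal{M}Q_j)(i2\pi\theta)\big|^2}{\big|\sum_{j=1}^\infty C_{X_j}(\tau)\,(\mathcal{M}Q_j)(i2\pi\theta)\big|^2+\sum_{j,k=1}^\infty\mathcal{M}(C_{X_j}C^*_{X_k})(i2\pi\theta)\,(Q_j\circledast Q_k^* )(\tau)},$$ where $(Q_j\circledast Q_k^* )(\tau)=\int_0^\infty Q_j(u\sqrt{\tau})\,Q_k^*(u/\sqrt{\tau})\,\frac{du}{u}$.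
   Context: $^*$ denotes complex conjugation and $\mathbb{R}^+=(0,\infty)$. Mellin transform: $(\mathcal{M}g)(s)=\int_0^\infty g(t)\,t^{-s-1}\,dt$. Locally self-similar process: a process with covariance of the form $Q(\sqrt{ts})\,C(t/s)$, where $Q(t)=t^{2H}q(\ln t)$, $Q$ and $C$ are continuous and not identically zero, $C$ is nonnegative definite on the multiplicative group $\mathbb{R}^+$, and $C(1)=1$, so that $Q\ge0$. Circularly symmetric: $\{e^{i\alpha}X(t)\}$ are identically distributed for all $\alpha\in[0,2\pi)$; consequently $E(X(t))=0$ and $E(X(t)X(s))=0$. Scale invariant ambiguity function: $A_X(\theta,\tau)=\int_0^\infty X(t\sqrt{\tau})\,X^*(t/\sqrt{\tau})\,t^{-i2\pi\theta-1}\,dt$ (mean-square integral); $A_{E,X}=E\{A_X\}$. The (global) optimal ambiguity-domain kernel of $X$ is $\phi(\theta,\tau)=\frac{|A_{E,X}(\theta,\tau)|^2}{E|A_X(\theta,\tau)|^2}$ where $E|A_X(\theta,\tau)|^2>0$, and $0$ elsewhere. Standing assumptions: the mean-square integrals exist, expectation and integration may be interchanged in computing $E\{A_X\}$ and $E|A_X|^2$, and the deterministic integrals and series that appear converge absolutely (so that sums and integrals may be interchanged). *)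

theory Defs
  imports "HOL-Probability.Probability"
begin

section \<open>Second-order processes on the positive half-line\<close>

text \<open>
  A process \<open>X(t), t > 0\<close> is a function \<open>X :: real \<Rightarrow> 'w \<Rightarrow> complex\<close>; its values at \<open>t \<le> 0\<close> are
  irrelevant.
\<close>

definition sq_integrable :: "'w measure \<Rightarrow> ('w \<Rightarrow> complex) \<Rightarrow> bool" where
  "sq_integrable M Y \<longleftrightarrow>
     Y \<in> borel_measurable M \<and> integrable M (\<lambda>w. (cmod (Y w))\<^sup>2)"

definition second_order_process :: "'w measure \<Rightarrow> (real \<Rightarrow> 'w \<Rightarrow> complex) \<Rightarrow> bool" where
  "second_order_process M X \<longleftrightarrow> (\<forall>t>0. sq_integrable M (X t))"

definition cov_fun :: "'w measure \<Rightarrow> (real \<Rightarrow> 'w \<Rightarrow> complex) \<Rightarrow> real \<Rightarrow> real \<Rightarrow> complex" where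
  "cov_fun M X t s = (\<integral>w. X t w * cnj (X s w) \<partial>M)"

text \<open>Constants count as (degenerate) Gaussian random variables.\<close>

definition gaussian_rv :: "'w measure \<Rightarrow> ('w \<Rightarrow> real) \<Rightarrow> bool" where
  "gaussian_rv M Y \<longleftrightarrow>
     Y \<in> borel_measurable M \<and>
     ((\<exists>\<mu> \<sigma>. \<sigma> > 0 \<and> distributed M lborel Y (normal_density \<mu> \<sigma>)) \<or>
      (\<exists>\<mu>. AE w in M. Y w = \<mu>))"

text \<open>
  Joint Gaussianity of the real and imaginary parts of the process, expressed by real linear
  combinations.
\<close>

definition gaussian_process :: "'w measure \<Rightarrow> (real \<Rightarrow> 'w \<Rightarrow> complex) \<Rightarrow> bool" where
  "gaussian_process M X \<longleftrightarrow>
     (\<forall>t>0. X t \<in> borel_measurable M) \<and>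
     (\<forall>I a b. finite I \<and> I \<subseteq> {0<..} \<longrightarrow>
        gaussian_rv M (\<lambda>w. \<Sum>t\<in>I. a t * Re (X t w) + b t * Im (X t w)))"

definition process_law ::
  "'w measure \<Rightarrow> (real \<Rightarrow> 'w \<Rightarrow> complex) \<Rightarrow> (real \<Rightarrow> complex) measure" where
  "process_law M X =
     distr M (PiM {0<..} (\<lambda>_. borel)) (\<lambda>w. restrict (\<lambda>t. X t w) {0<..})"

definition circularly_symmetric :: "'w measure \<Rightarrow> (real \<Rightarrow> 'w \<Rightarrow> complex) \<Rightarrow> bool" where
  "circularly_symmetric M X \<longleftrightarrow>
     (\<forall>t>0. X t \<in> borel_measurable M) \<and>
     (\<forall>\<alpha>\<in>{0..<2 * pi}.
        process_law M (\<lambda>t w. exp (\<i> * of_real \<alpha>) * X t w) = process_law M X)"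


section \<open>Locally self-similar processes\<close>

definition nonneg_definite :: "(real \<Rightarrow> complex) \<Rightarrow> bool" where
  "nonneg_definite C \<longleftrightarrow>
     (\<forall>I a. finite I \<and> I \<subseteq> {0<..} \<longrightarrow>
        (\<Sum>t\<in>I. \<Sum>s\<in>I. a t * cnj (a s) * C (t / s)) \<in> \<real>\<^sub>\<ge>\<^sub>0)"

definition locally_self_similar ::
  "'w measure \<Rightarrow> (real \<Rightarrow> 'w \<Rightarrow> complex) \<Rightarrow> (real \<Rightarrow> complex) \<Rightarrow> (real \<Rightarrow> complex) \<Rightarrow> bool" where
  "locally_self_similar M X Q C \<longleftrightarrow>
     second_order_process M X \<and>
     (\<forall>t>0. \<forall>s>0. cov_fun M X t s = Q (sqrt (t * s)) * C (t / s)) \<and>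
     (\<exists>H q. \<forall>t>0. Q t = of_real (t powr (2 * H)) * q (ln t)) \<and>
     continuous_on {0<..} Q \<and> (\<exists>t>0. Q t \<noteq> 0) \<and>
     continuous_on {0<..} C \<and> (\<exists>t>0. C t \<noteq> 0) \<and>
     nonneg_definite C \<and> C 1 = 1"

text \<open>
  \<open>Q(\<surd>(ts)) C(t/s)\<close> is the covariance function of some locally self-similar process. Fixing the
  sample space to be the path space \<open>real \<Rightarrow> complex\<close> is no restriction: a process on any
  probability space can be replaced by the coordinate process under its law.
\<close>

definition lss_covariance :: "(real \<Rightarrow> complex) \<Rightarrow> (real \<Rightarrow> complex) \<Rightarrow> bool" where
  "lss_covariance Q C \<longleftrightarrow>
     (\<exists>(N :: (real \<Rightarrow> complex) measure) Y. prob_space N \<and> locally_self_similar N Y Q C)"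

definition multicomponent_lss ::
  "'w measure \<Rightarrow> (real \<Rightarrow> 'w \<Rightarrow> complex) \<Rightarrow>
     (nat \<Rightarrow> real \<Rightarrow> complex) \<Rightarrow> (nat \<Rightarrow> real \<Rightarrow> complex) \<Rightarrow> bool" where
  "multicomponent_lss M X Q C \<longleftrightarrow>
     second_order_process M X \<and>
     (\<forall>j. lss_covariance (Q j) (C j)) \<and>
     (\<forall>t>0. \<forall>s>0. (\<lambda>j. Q j (sqrt (t * s)) * C j (t / s)) sums cov_fun M X t s)"


section \<open>Mean-square integrals\<close>

text \<open>Mean-square limit of Riemann sums over tagged partitions of \<open>[a,b]\<close> of vanishing mesh.\<close>

definition has_ms_integral_on ::
  "'w measure \<Rightarrow> (real \<Rightarrow> 'w \<Rightarrow> complex) \<Rightarrow> ('w \<Rightarrow> complex) \<Rightarrow> real \<Rightarrow> real \<Rightarrow> bool" where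
  "has_ms_integral_on M f J a b \<longleftrightarrow>
     (\<forall>t\<in>{a..b}. sq_integrable M (f t)) \<and> sq_integrable M J \<and>
     (\<forall>\<epsilon>>0. \<exists>\<delta>>0. \<forall>p. p tagged_division_of {a..b} \<and> (\<lambda>t. ball t \<delta>) fine p \<longrightarrow>
        (\<integral>w. (cmod ((\<Sum>(t, K)\<in>p. measure lborel K *\<^sub>R f t w) - J w))\<^sup>2 \<partial>M) < \<epsilon>)"

text \<open>Improper mean-square integral over \<open>(0,\<infinity>)\<close>.\<close>

definition has_ms_integral ::
  "'w measure \<Rightarrow> (real \<Rightarrow> 'w \<Rightarrow> complex) \<Rightarrow> ('w \<Rightarrow> complex) \<Rightarrow> bool" where
  "has_ms_integral M f J \<longleftrightarrow>
     sq_integrable M J \<and>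
     (\<exists>K. (\<forall>a b. 0 < a \<and> a < b \<longrightarrow> has_ms_integral_on M f (K a b) a b) \<and>
          ((\<lambda>(a, b). \<integral>w. (cmod (K a b w - J w))\<^sup>2 \<partial>M) \<longlongrightarrow> 0) (at_right 0 \<times>\<^sub>F at_top))"

definition ms_integrable :: "'w measure \<Rightarrow> (real \<Rightarrow> 'w \<Rightarrow> complex) \<Rightarrow> bool" where
  "ms_integrable M f \<longleftrightarrow> (\<exists>J. has_ms_integral M f J)"

text \<open>Determined up to null sets only; everything below depends on it through expectations.\<close>

definition ms_integral :: "'w measure \<Rightarrow> (real \<Rightarrow> 'w \<Rightarrow> complex) \<Rightarrow> 'w \<Rightarrow> complex" where
  "ms_integral M f = (SOME J. has_ms_integral M f J)"


section \<open>Scale invariant ambiguity function and optimal kernel\<close>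

definition amb_integrand ::
  "(real \<Rightarrow> 'w \<Rightarrow> complex) \<Rightarrow> real \<Rightarrow> real \<Rightarrow> real \<Rightarrow> 'w \<Rightarrow> complex" where
  "amb_integrand X \<theta> \<tau> t w =
     X (t * sqrt \<tau>) w * cnj (X (t / sqrt \<tau>) w)
       * of_real t powr (- (\<i> * of_real (2 * pi * \<theta>)) - 1)"

definition ambiguity_fun ::
  "'w measure \<Rightarrow> (real \<Rightarrow> 'w \<Rightarrow> complex) \<Rightarrow> real \<Rightarrow> real \<Rightarrow> 'w \<Rightarrow> complex" where
  "ambiguity_fun M X \<theta> \<tau> = ms_integral M (amb_integrand X \<theta> \<tau>)"

definition expected_ambiguity ::
  "'w measure \<Rightarrow> (real \<Rightarrow> 'w \<Rightarrow> complex) \<Rightarrow> real \<Rightarrow> real \<Rightarrow> complex" where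
  "expected_ambiguity M X \<theta> \<tau> = (\<integral>w. ambiguity_fun M X \<theta> \<tau> w \<partial>M)"

definition ambiguity_power ::
  "'w measure \<Rightarrow> (real \<Rightarrow> 'w \<Rightarrow> complex) \<Rightarrow> real \<Rightarrow> real \<Rightarrow> real" where
  "ambiguity_power M X \<theta> \<tau> = (\<integral>w. (cmod (ambiguity_fun M X \<theta> \<tau> w))\<^sup>2 \<partial>M)"

definition optimal_kernel ::
  "'w measure \<Rightarrow> (real \<Rightarrow> 'w \<Rightarrow> complex) \<Rightarrow> real \<Rightarrow> real \<Rightarrow> real" where
  "optimal_kernel M X \<theta> \<tau> =
     (if ambiguity_power M X \<theta> \<tau> > 0
      then (cmod (expected_ambiguity M X \<theta> \<tau>))\<^sup>2 / ambiguity_power M X \<theta> \<tau>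
      else 0)"


section \<open>Mellin transform and multiplicative convolution\<close>

text \<open>The \<open>_abs\<close> variants are the integrals of the absolute values of the integrands.\<close>

definition mellin :: "(real \<Rightarrow> complex) \<Rightarrow> complex \<Rightarrow> complex" where
  "mellin g s = (LINT t:{0<..}|lborel. g t * of_real t powr (- s - 1))"

definition mellin_integrable :: "(real \<Rightarrow> complex) \<Rightarrow> complex \<Rightarrow> bool" where
  "mellin_integrable g s \<longleftrightarrow>
     set_integrable lborel {0<..} (\<lambda>t. g t * of_real t powr (- s - 1))"

definition mellin_abs :: "(real \<Rightarrow> complex) \<Rightarrow> complex \<Rightarrow> real" where
  "mellin_abs g s = (LINT t:{0<..}|lborel. cmod (g t * of_real t powr (- s - 1)))"

definition mconv :: "(real \<Rightarrow> complex) \<Rightarrow> (real \<Rightarrow> complex) \<Rightarrow> real \<Rightarrow> complex" where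
  "mconv f g \<tau> = (LINT u:{0<..}|lborel. f (u * sqrt \<tau>) * g (u / sqrt \<tau>) / of_real u)"

definition mconv_integrable :: "(real \<Rightarrow> complex) \<Rightarrow> (real \<Rightarrow> complex) \<Rightarrow> real \<Rightarrow> bool" where
  "mconv_integrable f g \<tau> \<longleftrightarrow>
     set_integrable lborel {0<..} (\<lambda>u. f (u * sqrt \<tau>) * g (u / sqrt \<tau>) / of_real u)"

definition mconv_abs :: "(real \<Rightarrow> complex) \<Rightarrow> (real \<Rightarrow> complex) \<Rightarrow> real \<Rightarrow> real" where
  "mconv_abs f g \<tau> =
     (LINT u:{0<..}|lborel. cmod (f (u * sqrt \<tau>) * g (u / sqrt \<tau>) / of_real u))"

end

theory Submission
  imports Defs
begin

text \<open>
  For a circularly symmetric Gaussian process Isserlis' formula gives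
  \<open>E[X\<^sub>1 X\<^sub>2\<^sup>* X\<^sub>3 X\<^sub>4\<^sup>*] = E[X\<^sub>1 X\<^sub>2\<^sup>*] E[X\<^sub>3 X\<^sub>4\<^sup>*] + E[X\<^sub>1 X\<^sub>4\<^sup>*] E[X\<^sub>3 X\<^sub>2\<^sup>*]\<close>.
  Applied to the integrand of \<open>E|A\<^sub>X|\<^sup>2\<close>, the first product integrates to \<open>|E A\<^sub>X|\<^sup>2\<close>. In the second,
  \<open>C\<^sub>k(s/t) = C\<^sub>k(t/s)\<^sup>*\<close> and \<open>Q\<^sub>k\<close> is real, so it is a double series of functions of
  \<open>v = t/s\<close> times functions of \<open>u = \<surd>(ts)\<close>; the map \<open>(t,s) \<mapsto> (v,u)\<close> preserves the measure
  \<open>dt/t ds/s\<close>, so each term integrates to a Mellin transform times a multiplicative convolution.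
\<close>

section \<open>Fourth moments of circular Gaussian processes\<close>

lemma borel_measurable_cnj [measurable]: "cnj \<in> borel_measurable borel"
  by (intro borel_measurable_continuous_onI continuous_intros)


text \<open>Applying xy \<le> (x^2 + y^2)/2 twice dominates the modulus of the product by the sum of
  the four fourth powers. This makes every mixed fourth moment finite, so the expectations below may
  be expanded linearly.\<close>

lemma quartic_moments_mult_integrable:
  fixes Z1 Z2 Z3 Z4 :: "'w \<Rightarrow> complex"
  assumes "Z1 \<in> borel_measurable M" "integrable M (\<lambda>w. (cmod (Z1 w)) ^ 4)"
    and "Z2 \<in> borel_measurable M" "integrable M (\<lambda>w. (cmod (Z2 w)) ^ 4)"
    and "Z3 \<in> borel_measurable M" "integrable M (\<lambda>w. (cmod (Z3 w)) ^ 4)"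
    and "Z4 \<in> borel_measurable M" "integrable M (\<lambda>w. (cmod (Z4 w)) ^ 4)"
  shows "integrable M (\<lambda>w. Z1 w * Z2 w * Z3 w * Z4 w)"
proof (rule Bochner_Integration.integrable_bound)
  show "integrable M (\<lambda>w. cmod (Z1 w) ^ 4 + cmod (Z2 w) ^ 4 + cmod (Z3 w) ^ 4 + cmod (Z4 w) ^ 4)"
    using assms by simp
  show "(\<lambda>w. Z1 w * Z2 w * Z3 w * Z4 w) \<in> borel_measurable M"
    using assms by measurable
  have "a * b * c * d \<le> a ^ 4 + b ^ 4 + c ^ 4 + d ^ 4" for a b c d :: real
  proof -
    have 1: "x * y \<le> (x\<^sup>2 + y\<^sup>2) / 2" for x y :: real
      using zero_le_power2[of "x - y"] by (simp add: power2_eq_square algebra_simps)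
    have "a * b * c * d \<le> ((a * b)\<^sup>2 + (c * d)\<^sup>2) / 2" using 1[of "a * b" "c * d"] by (simp add: mult_ac)
    also have "\<dots> \<le> ((a ^ 4 + b ^ 4) / 2 + (c ^ 4 + d ^ 4) / 2) / 2"
      using 1[of "a\<^sup>2" "b\<^sup>2"] 1[of "c\<^sup>2" "d\<^sup>2"] by (simp add: power_mult_distrib field_simps)
    also have "\<dots> \<le> a ^ 4 + b ^ 4 + c ^ 4 + d ^ 4"
      using zero_le_even_power[of 4 a] zero_le_even_power[of 4 b] zero_le_even_power[of 4 c]
        zero_le_even_power[of 4 d] by (simp add: field_simps)
    finally show ?thesis .
  qed
  then show "AE w in M. norm (Z1 w * Z2 w * Z3 w * Z4 w)
      \<le> norm (cmod (Z1 w) ^ 4 + cmod (Z2 w) ^ 4 + cmod (Z3 w) ^ 4 + cmod (Z4 w) ^ 4)"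
    by (auto simp: norm_mult)
qed

lemma (in prob_space) quartic_moment_imp_sq_moment:
  fixes Z :: "'a \<Rightarrow> complex"
  assumes "Z \<in> borel_measurable M" "integrable M (\<lambda>w. (cmod (Z w)) ^ 4)"
  shows "integrable M (\<lambda>w. (cmod (Z w))\<^sup>2)"
proof (rule Bochner_Integration.integrable_bound)
  show "integrable M (\<lambda>w. 1 + cmod (Z w) ^ 4)" using assms by simp
  show "(\<lambda>w. (cmod (Z w))\<^sup>2) \<in> borel_measurable M" using assms by measurable
  have "x\<^sup>2 \<le> 1 + x ^ 4" for x :: real
    \<comment> \<open>Expanding the square gives x^2 \<le> x^4 + 1/4.\<close>
    using zero_le_power2[of "x\<^sup>2 - 1/2"] by (simp add: power2_eq_square power4_eq_xxxx algebra_simps)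
  then show "AE w in M. norm ((cmod (Z w))\<^sup>2) \<le> norm (1 + cmod (Z w) ^ 4)" by auto
qed

lemma square_moments_mult_integrable:
  fixes Z W :: "'w \<Rightarrow> complex"
  assumes "Z \<in> borel_measurable M" "integrable M (\<lambda>w. (cmod (Z w))\<^sup>2)"
    and "W \<in> borel_measurable M" "integrable M (\<lambda>w. (cmod (W w))\<^sup>2)"
  shows "integrable M (\<lambda>w. Z w * W w)"
proof (rule Bochner_Integration.integrable_bound)
  show "integrable M (\<lambda>w. (cmod (Z w))\<^sup>2 + (cmod (W w))\<^sup>2)" using assms by simp
  show "(\<lambda>w. Z w * W w) \<in> borel_measurable M" using assms by measurable
  have "x * y \<le> x\<^sup>2 + y\<^sup>2" if "x \<ge> 0" "y \<ge> 0" for x y :: real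
    using zero_le_power2[of "x - y"] mult_nonneg_nonneg[OF that] by (simp add: power2_eq_square algebra_simps)
  then show "AE w in M. norm (Z w * W w) \<le> norm ((cmod (Z w))\<^sup>2 + (cmod (W w))\<^sup>2)"
    by (auto simp: norm_mult)
qed

text \<open>Polarisation with \<open>a\<close> running over the fourth roots of unity, first of
  \<open>E|Z + aW|\<^sup>4\<close> and then of each of the two factors of \<open>E|Z|\<^sup>2|W|\<^sup>2\<close>.\<close>

lemma (in prob_space) circular_isserlis:
  fixes S :: "('a \<Rightarrow> complex) set"
  assumes closed: "\<And>Z W a. Z \<in> S \<Longrightarrow> W \<in> S \<Longrightarrow> (\<lambda>w. Z w + a * W w) \<in> S"
    and meas: "\<And>Z. Z \<in> S \<Longrightarrow> Z \<in> borel_measurable M"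
    and int4: "\<And>Z. Z \<in> S \<Longrightarrow> integrable M (\<lambda>w. (cmod (Z w)) ^ 4)"
    and wick: "\<And>Z. Z \<in> S \<Longrightarrow> (\<integral>w. (Z w * cnj (Z w))\<^sup>2 \<partial>M) = 2 * (\<integral>w. Z w * cnj (Z w) \<partial>M)\<^sup>2"
    and S: "Z1 \<in> S" "Z2 \<in> S" "W1 \<in> S" "W2 \<in> S"
  shows "(\<integral>w. Z1 w * cnj (Z2 w) * (W1 w * cnj (W2 w)) \<partial>M) =
    (\<integral>w. Z1 w * cnj (Z2 w) \<partial>M) * (\<integral>w. W1 w * cnj (W2 w) \<partial>M) +
    (\<integral>w. Z1 w * cnj (W2 w) \<partial>M) * (\<integral>w. W1 w * cnj (Z2 w) \<partial>M)"
proof -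
  have int2: "integrable M (\<lambda>w. A w * cnj (B w))" if "A \<in> S" "B \<in> S" for A B
    using that meas int4 by (intro square_moments_mult_integrable quartic_moment_imp_sq_moment)
      (auto intro: measurable_compose[OF _ borel_measurable_cnj])
  have int: "integrable M (\<lambda>w. A w * cnj (B w) * (C w * cnj (D w)))" if "A \<in> S" "B \<in> S" "C \<in> S" "D \<in> S" for A B C D
    using quartic_moments_mult_integrable[of A M "\<lambda>w. cnj (B w)" C "\<lambda>w. cnj (D w)"] that meas int4
    by (simp add: mult.assoc measurable_compose[OF _ borel_measurable_cnj])
  \<comment> \<open>\<open>E2\<close> is linear in its first slot and conjugate linear in its
    second; \<open>E4\<close> is linear in slots 1 and 3 and conjugate linear in slots 2 and 4. The
    right-hand side of the claim has the same type, which is what polarisation needs.\<close>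
  define E2 where "E2 A B = (\<integral>w. A w * cnj (B w) \<partial>M)" for A B
  define E4 where "E4 A B C D = (\<integral>w. A w * cnj (B w) * (C w * cnj (D w)) \<partial>M)" for A B C D
  have E2l: "E2 (\<lambda>w. A w + a * B w) C = E2 A C + a * E2 B C" if "A \<in> S" "B \<in> S" "C \<in> S" for A B C a
    using int2 that unfolding E2_def by (simp add: ring_distribs mult.assoc)
  have E2r: "E2 C (\<lambda>w. A w + a * B w) = E2 C A + cnj a * E2 C B" if "A \<in> S" "B \<in> S" "C \<in> S" for A B C a
  proof -
    have "E2 C (\<lambda>w. A w + a * B w) = (\<integral>w. C w * cnj (A w) + cnj a * (C w * cnj (B w)) \<partial>M)"
      unfolding E2_def by (intro Bochner_Integration.integral_cong refl) (simp add: algebra_simps)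
    then show ?thesis using int2 that by (simp add: E2_def)
  qed
  have E41: "E4 (\<lambda>w. A w + a * A' w) B C D = E4 A B C D + a * E4 A' B C D"
    if "A \<in> S" "A' \<in> S" "B \<in> S" "C \<in> S" "D \<in> S" for A A' B C D a
    using int that unfolding E4_def by (simp add: ring_distribs mult.assoc)
  have E42: "E4 A (\<lambda>w. B w + a * B' w) C D = E4 A B C D + cnj a * E4 A B' C D"
    if "A \<in> S" "B \<in> S" "B' \<in> S" "C \<in> S" "D \<in> S" for A B B' C D a
  proof -
    have "E4 A (\<lambda>w. B w + a * B' w) C D =
      (\<integral>w. A w * cnj (B w) * (C w * cnj (D w)) + cnj a * (A w * cnj (B' w) * (C w * cnj (D w))) \<partial>M)"
      unfolding E4_def by (intro Bochner_Integration.integral_cong refl) (simp add: algebra_simps)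
    then show ?thesis using int that by (simp add: E4_def)
  qed
  \<comment> \<open>\<open>E4\<close> does not change when its two plain arguments, or its two
    conjugated ones, are exchanged. This yields linearity in the last two slots and identifies the
    mixed terms in \<open>step1\<close>.\<close>
  have swap: "E4 A B C D = E4 C D A B" "E4 A B C D = E4 A D C B" for A B C D
    by (simp_all add: E4_def mult_ac)
  have swap': "E4 A B C D = E4 C B A D" for A B C D
    by (simp add: E4_def mult_ac)
  have E43: "E4 A B (\<lambda>w. C w + a * C' w) D = E4 A B C D + a * E4 A B C' D"
    if "A \<in> S" "C' \<in> S" "B \<in> S" "C \<in> S" "D \<in> S" for A B C C' D a
    using E41[of C C' D A B a] that swap(1) by metis
  have E44: "E4 A B C (\<lambda>w. D w + a * D' w) = E4 A B C D + cnj a * E4 A B C D'"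
    if "A \<in> S" "D' \<in> S" "B \<in> S" "C \<in> S" "D \<in> S" for A B C D D' a
    using E42[of C D D' A B a] that swap(1) by metis
  have wick': "E4 Z Z Z Z = 2 * (E2 Z Z)\<^sup>2" if "Z \<in> S" for Z
    using wick[OF that] by (simp add: E4_def E2_def power2_eq_square)
  have step1: "E4 Z Z W W = E2 Z Z * E2 W W + E2 Z W * E2 W Z" if [simp]: "Z \<in> S" "W \<in> S" for Z W
  proof -
    have *: "E4 (\<lambda>w. Z w + a * W w) (\<lambda>w. Z w + a * W w) (\<lambda>w. Z w + a * W w) (\<lambda>w. Z w + a * W w)
      = 2 * (E2 (\<lambda>w. Z w + a * W w) (\<lambda>w. Z w + a * W w))\<^sup>2" for a
      by (rule wick') (simp add: closed)
    have sw: "E4 W W Z Z = E4 Z Z W W" "E4 Z W W Z = E4 Z Z W W" "E4 W Z Z W = E4 Z Z W W"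
      by (metis swap swap')+
    note expand = E2l E2r E41 E42 E43 E44 closed
    let ?F = "\<lambda>a. E4 (\<lambda>w. Z w + a * W w) (\<lambda>w. Z w + a * W w) (\<lambda>w. Z w + a * W w) (\<lambda>w. Z w + a * W w)"
    \<comment> \<open>Summing over the fourth roots of unity keeps only monomials with as many
      factors a as \<open>cnj a\<close>. There is one without a, one with all four slots filled by
      W, and four mixed ones, all equal to \<open>E4 Z Z W W\<close>; each is counted four
      times.\<close>
    have "16 * E4 Z Z W W + 4 * E4 Z Z Z Z + 4 * E4 W W W W = ?F 1 + ?F (-1) + ?F \<i> + ?F (-\<i>)"
      by (simp only: expand that, simp only: sw, simp add: algebra_simps)
    also have "\<dots> = 8 * ((E2 Z Z + E2 W W)\<^sup>2 + 2 * E2 Z W * E2 W Z)"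
      unfolding *
      by (simp only: expand that, simp add: power2_eq_square algebra_simps)
    finally have "16 * E4 Z Z W W = 16 * (E2 Z Z * E2 W W + E2 Z W * E2 W Z)"
      unfolding wick'[OF that(1)] wick'[OF that(2)] by (simp add: power2_eq_square algebra_simps)
    then show ?thesis by (simp only: mult_cancel_left) simp
  qed
  have step2: "E4 Z1 Z2 W W = E2 Z1 Z2 * E2 W W + E2 Z1 W * E2 W Z2"
    if [simp]: "Z1 \<in> S" "Z2 \<in> S" "W \<in> S" for Z1 Z2 W
  proof -
    note expand = E2l E2r E41 E42 closed that
    have *: "E4 (\<lambda>w. Z1 w + a * Z2 w) (\<lambda>w. Z1 w + a * Z2 w) W W
      = E2 (\<lambda>w. Z1 w + a * Z2 w) (\<lambda>w. Z1 w + a * Z2 w) * E2 W W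
        + E2 (\<lambda>w. Z1 w + a * Z2 w) W * E2 W (\<lambda>w. Z1 w + a * Z2 w)" for a
      by (rule step1) (simp_all add: closed)
    let ?F = "\<lambda>a. E4 (\<lambda>w. Z1 w + a * Z2 w) (\<lambda>w. Z1 w + a * Z2 w) W W"
    \<comment> \<open>This is the sum of a F(a) over the fourth roots of unity a. It isolates the
      coefficient of \<open>cnj a\<close>, both here and in the right-hand side supplied by
      \<open>step1\<close>.\<close>
    have "4 * E4 Z1 Z2 W W = ?F 1 - ?F (-1) + \<i> * ?F \<i> - \<i> * ?F (-\<i>)"
      by (simp only: expand) (simp add: algebra_simps)
    also have "\<dots> = 4 * (E2 Z1 Z2 * E2 W W + E2 Z1 W * E2 W Z2)"
      unfolding * by (simp only: expand) (simp add: algebra_simps)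
    finally show ?thesis by (simp only: mult_cancel_left) simp
  qed
  have "E4 Z1 Z2 W1 W2 = E2 Z1 Z2 * E2 W1 W2 + E2 Z1 W2 * E2 W1 Z2"
  proof -
    note expand = E2l E2r E43 E44 closed S
    have *: "E4 Z1 Z2 (\<lambda>w. W1 w + a * W2 w) (\<lambda>w. W1 w + a * W2 w)
      = E2 Z1 Z2 * E2 (\<lambda>w. W1 w + a * W2 w) (\<lambda>w. W1 w + a * W2 w)
        + E2 Z1 (\<lambda>w. W1 w + a * W2 w) * E2 (\<lambda>w. W1 w + a * W2 w) Z2" for a
      by (rule step2) (simp_all add: closed S)
    let ?F = "\<lambda>a. E4 Z1 Z2 (\<lambda>w. W1 w + a * W2 w) (\<lambda>w. W1 w + a * W2 w)"
    have "4 * E4 Z1 Z2 W1 W2 = ?F 1 - ?F (-1) + \<i> * ?F \<i> - \<i> * ?F (-\<i>)"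
      by (simp only: expand) (simp add: algebra_simps)
    also have "\<dots> = 4 * (E2 Z1 Z2 * E2 W1 W2 + E2 Z1 W2 * E2 W1 Z2)"
      unfolding * by (simp only: expand) (simp add: algebra_simps)
    finally show ?thesis by (simp only: mult_cancel_left) simp
  qed
  then show ?thesis by (simp add: E4_def E2_def)
qed

text \<open>\<open>gaussian_rv\<close> admits constants, hence two cases: a centred constant is
  almost surely 0, and otherwise the normal density gives second moment \<sigma>^2 and fourth moment
  3 \<sigma>^4.\<close>

lemma centred_gaussian_moments:
  assumes "gaussian_rv M Y" "prob_space M" "(\<integral>w. Y w \<partial>M) = 0"
  shows "integrable M (\<lambda>w. Y w ^ 4)" "(\<integral>w. Y w ^ 4 \<partial>M) = 3 * (\<integral>w. (Y w)\<^sup>2 \<partial>M)\<^sup>2"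
proof -
  interpret prob_space M by fact
  have [measurable]: "Y \<in> borel_measurable M" using assms(1) by (simp add: gaussian_rv_def)
  have "integrable M (\<lambda>w. Y w ^ 4) \<and> (\<integral>w. Y w ^ 4 \<partial>M) = 3 * (\<integral>w. (Y w)\<^sup>2 \<partial>M)\<^sup>2"
  proof (cases "\<exists>\<mu>. AE w in M. Y w = \<mu>")
    case True
    then obtain \<mu> where m: "AE w in M. Y w = \<mu>" by blast
    have "(\<integral>w. Y w \<partial>M) = (\<integral>w. \<mu> \<partial>M)" using m by (intro integral_cong_AE) auto
    with assms(3) have "\<mu> = 0" by (simp add: prob_space)
    with m have 0: "AE w in M. Y w = 0" by simp
    then have "AE w in M. Y w ^ 4 = 0" "AE w in M. (Y w)\<^sup>2 = 0" by auto
    then have "(\<integral>w. Y w ^ 4 \<partial>M) = 0" "(\<integral>w. (Y w)\<^sup>2 \<partial>M) = 0" "integrable M (\<lambda>w. Y w ^ 4)"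
      using integrable_cong_AE[of "\<lambda>w. Y w ^ 4" M "\<lambda>_. 0"]
      by (simp_all only: integral_eq_zero_AE) auto
    then show ?thesis by simp
  next
    case False
    then obtain \<mu> \<sigma> where s: "\<sigma> > 0" and D: "distributed M lborel Y (normal_density \<mu> \<sigma>)"
      using assms(1) by (auto simp: gaussian_rv_def)
    have "(\<integral>w. Y w \<partial>M) = \<mu>" using normal_distributed_expectation[OF s D] by simp
    with assms(3) have D: "distributed M lborel Y (normal_density 0 \<sigma>)" using D by simp
    have I: "integrable M (\<lambda>w. Y w ^ 4)"
      using distributed_integrable[OF D, of "\<lambda>x. x ^ 4"] integrable_normal_moment[OF s, of 0 4] by simp
    have 4: "(\<integral>w. Y w ^ 4 \<partial>M) = 3 * \<sigma> ^ 4"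
      using distributed_integral[OF D, of "\<lambda>x. x ^ 4"] integral_normal_moment_even[OF s, of 0 2] s
      by (simp add: fact_numeral power2_eq_square power4_eq_xxxx field_simps)
    have "(\<integral>w. Y w ^ 2 \<partial>M) = \<sigma>\<^sup>2"
      using distributed_integral[OF D, of "\<lambda>x. x ^ 2"] integral_normal_moment_even[OF s, of 0 1] s
      by (simp add: fact_numeral power2_eq_square field_simps)
    with I 4 show ?thesis by simp
  qed
  then show "integrable M (\<lambda>w. Y w ^ 4)" "(\<integral>w. Y w ^ 4 \<partial>M) = 3 * (\<integral>w. (Y w)\<^sup>2 \<partial>M)\<^sup>2" by auto
qed

text \<open>Since E Z^2 = 0, every projection Re(aZ) is a centred Gaussian of variance |a|^2 E|Z|^2
  / 2, so its fourth moment is known. The fourth power of |Z| is a combination of four such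
  projections.\<close>

lemma circular_gaussian_fourth_moment:
  fixes Z :: "'w \<Rightarrow> complex"
  assumes "prob_space M" and meas [measurable]: "Z \<in> borel_measurable M"
    and G: "\<And>a. gaussian_rv M (\<lambda>w. Re (a * Z w))"
    and int: "integrable M Z" "integrable M (\<lambda>w. (cmod (Z w))\<^sup>2)"
    and mean: "(\<integral>w. Z w \<partial>M) = 0" and pseudo: "(\<integral>w. (Z w)\<^sup>2 \<partial>M) = 0"
  shows "integrable M (\<lambda>w. cmod (Z w) ^ 4)"
    and "(\<integral>w. (Z w * cnj (Z w))\<^sup>2 \<partial>M) = 2 * (\<integral>w. Z w * cnj (Z w) \<partial>M)\<^sup>2"
proof -
  define v where "v = (\<integral>w. (cmod (Z w))\<^sup>2 \<partial>M)"
  have intsq: "integrable M (\<lambda>w. (Z w)\<^sup>2)"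
    using square_moments_mult_integrable[of Z M Z] int by (simp add: power2_eq_square)
  have m4: "integrable M (\<lambda>w. Re (a * Z w) ^ 4)"
      "(\<integral>w. Re (a * Z w) ^ 4 \<partial>M) = 3 * ((cmod a)\<^sup>2 * v / 2)\<^sup>2" for a
  proof -
    have 0: "(\<integral>w. Re (a * Z w) \<partial>M) = 0" using int mean by simp
    \<comment> \<open>Splits the second moment of a projection into a multiple of E|Z|^2 and a
      multiple of the pseudo-variance, which vanishes.\<close>
    have *: "(Re z)\<^sup>2 = ((cmod z)\<^sup>2 + Re (z\<^sup>2)) / 2" for z
      by (simp only: cmod_power2) (simp add: power2_eq_square field_simps)
    have "(\<integral>w. (Re (a * Z w))\<^sup>2 \<partial>M)
        = (\<integral>w. ((cmod a)\<^sup>2 * (cmod (Z w))\<^sup>2 + Re (a\<^sup>2 * (Z w)\<^sup>2)) / 2 \<partial>M)"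
      unfolding * by (simp add: norm_mult power_mult_distrib)
    also have "\<dots> = ((cmod a)\<^sup>2 * v + Re (a\<^sup>2 * (\<integral>w. (Z w)\<^sup>2 \<partial>M))) / 2"
      using int(2) intsq by (simp add: v_def del: Re_complex_div_eq_0)
    finally have 2: "(\<integral>w. (Re (a * Z w))\<^sup>2 \<partial>M) = (cmod a)\<^sup>2 * v / 2" by (simp add: pseudo)
    show "integrable M (\<lambda>w. Re (a * Z w) ^ 4)"
      "(\<integral>w. Re (a * Z w) ^ 4 \<partial>M) = 3 * ((cmod a)\<^sup>2 * v / 2)\<^sup>2"
      by (rule centred_gaussian_moments(1)[OF G assms(1) 0],
          rule centred_gaussian_moments(2)[OF G assms(1) 0, unfolded 2])
  qed
  \<comment> \<open>the average of \<open>(Re (e\<^sup>i\<^sup>\<alpha> z))\<^sup>4\<close> over four equidistant angles is \<open>3/8 |z|\<^sup>4\<close>\<close>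
  have id: "cmod z ^ 4 = (Re (1 * z) ^ 4 + Re (\<i> * z) ^ 4
      + (Re ((1 + \<i>) * z) ^ 4 + Re ((1 - \<i>) * z) ^ 4) / 4) * (2 / 3)" for z
  proof -
    have "cmod z ^ 4 = ((cmod z)\<^sup>2)\<^sup>2" by simp
    also have "\<dots> = ((Re z)\<^sup>2 + (Im z)\<^sup>2)\<^sup>2" by (simp only: cmod_power2)
    finally show ?thesis by (simp add: power2_eq_square power4_eq_xxxx field_simps)
  qed
  show I: "integrable M (\<lambda>w. cmod (Z w) ^ 4)"
    unfolding id using m4(1)[of 1] m4(1)[of \<i>] m4(1)[of "1 + \<i>"] m4(1)[of "1 - \<i>"]
    by (intro integrable_mult_left Bochner_Integration.integrable_add integrable_divide) auto
  \<comment> \<open>The directions 1 and \<i> contribute 3/4 v^2 each. The diagonal ones have |a|^2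
    = 2 and contribute 3 v^2 each before the division by 4. The total 3 v^2 is then multiplied by
    2/3.\<close>
  have "(\<integral>w. cmod (Z w) ^ 4 \<partial>M) = 2 * v\<^sup>2"
    unfolding id using m4[of 1] m4[of \<i>] m4[of "1 + \<i>"] m4[of "1 - \<i>"]
    by (simp add: cmod_power2 del: times_complex.sel, simp add: cmod_power2 power2_eq_square)
  then have "of_real (\<integral>w. cmod (Z w) ^ 4 \<partial>M) = (2 * (of_real v)\<^sup>2 :: complex)" by simp
  moreover have "(Z w * cnj (Z w))\<^sup>2 = of_real (cmod (Z w) ^ 4)" for w
    by (simp only: complex_norm_square[symmetric]) simp
  moreover have "Z w * cnj (Z w) = of_real ((cmod (Z w))\<^sup>2)" for w
    by (simp only: complex_norm_square[symmetric])
  ultimately show "(\<integral>w. (Z w * cnj (Z w))\<^sup>2 \<partial>M) = 2 * (\<integral>w. Z w * cnj (Z w) \<partial>M)\<^sup>2"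
    by (simp only: integral_complex_of_real v_def)
qed


text \<open>Equality of the path laws transfers to expectations of coordinate functionals. Rotation
  by pi changes the sign of X(t), rotation by pi/2 that of X(t) X(s), so both expectations equal
  their own negatives.\<close>

lemma circularly_symmetric_moments:
  assumes "prob_space M" and circ: "circularly_symmetric M X" and "second_order_process M X"
    and t: "t > 0" and s: "s > 0"
  shows "integrable M (X t)" "(\<integral>w. X t w \<partial>M) = 0" "(\<integral>w. X t w * X s w \<partial>M) = 0"
proof -
  interpret prob_space M by fact
  have X: "X t \<in> borel_measurable M" if "t > 0" for t using circ that by (simp add: circularly_symmetric_def)
  have R: "(\<lambda>w. restrict (\<lambda>t. a * X t w) {0<..}) \<in> measurable M (PiM {0<..} (\<lambda>_. borel))" for a
    using X by (intro measurable_restrict) auto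
  have rot: "(\<integral>w. f (restrict (\<lambda>t. exp (\<i> * of_real \<alpha>) * X t w) {0<..}) \<partial>M)
      = (\<integral>w. f (restrict (\<lambda>t. X t w) {0<..}) \<partial>M)"
    if "\<alpha> \<in> {0..<2 * pi}" "f \<in> borel_measurable (PiM {0<..} (\<lambda>_. borel))" for f :: "_ \<Rightarrow> complex" and \<alpha>
  proof -
    have "process_law M (\<lambda>t w. exp (\<i> * of_real \<alpha>) * X t w) = process_law M X"
      using circ that by (auto simp: circularly_symmetric_def)
    then have "integral\<^sup>L (process_law M (\<lambda>t w. exp (\<i> * of_real \<alpha>) * X t w)) f = integral\<^sup>L (process_law M X) f"
      by simp
    then show ?thesis
      using R[of 1] unfolding process_law_def by (simp add: integral_distr[OF R that(2)] integral_distr[OF _ that(2)])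
  qed
  have I: "integrable M (X t)"
    using square_integrable_imp_integrable[of "\<lambda>w. cmod (X t w)"] X[OF t] assms(3) t
    by (simp add: second_order_process_def sq_integrable_def integrable_norm_iff)
  then show "integrable M (X t)" .
  have 1: "t \<in> {0<..}" "s \<in> {0<..}" using t s by auto
  have "(\<integral>w. exp (\<i> * of_real pi) * X t w \<partial>M) = (\<integral>w. X t w \<partial>M)"
    using rot[of pi "\<lambda>x. x t"] 1 t by (auto intro: measurable_component_singleton)
  then show "(\<integral>w. X t w \<partial>M) = 0" by simp
  have "(\<integral>w. (exp (\<i> * of_real (pi/2)) * X t w) * (exp (\<i> * of_real (pi/2)) * X s w) \<partial>M) = (\<integral>w. X t w * X s w \<partial>M)"
    using rot[of "pi/2" "\<lambda>x. x t * x s"] 1 t s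
    by (auto intro!: borel_measurable_times measurable_component_singleton)
  moreover have "exp (\<i> * of_real (pi/2)) = \<i>" by (metis cis_conv_exp cis_pi_half)
  ultimately have "(\<integral>w. - (X t w * X s w) \<partial>M) = (\<integral>w. X t w * X s w \<partial>M)" by (simp add: mult_ac)
  then show "(\<integral>w. X t w * X s w \<partial>M) = 0" by simp
qed

text \<open>The complex span of the four variables is closed under linear combinations, and each of
  its members is a centred Gaussian with vanishing pseudo-variance, so
  \<open>circular_isserlis\<close> applies to the span.\<close>

lemma circular_gaussian_process_isserlis:
  assumes P: "prob_space M" and circ: "circularly_symmetric M X" and so: "second_order_process M X"
    and G: "gaussian_process M X"
    and pos: "t1 > 0" "t2 > 0" "s1 > 0" "s2 > 0"
  shows "(\<integral>w. X t1 w * cnj (X t2 w) * (X s1 w * cnj (X s2 w)) \<partial>M) =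
    cov_fun M X t1 t2 * cov_fun M X s1 s2 + cov_fun M X t1 s2 * cov_fun M X s1 t2"
proof -
  interpret prob_space M by fact
  \<comment> \<open>Coinciding times merge in this set; each of the four variables is still a member
    of the span, with an indicator as coefficient function.\<close>
  define I where "I = {t1, t2, s1, s2}"
  have I: "finite I" "I \<subseteq> {0<..}" "\<And>t. t \<in> I \<Longrightarrow> t > 0" using pos by (auto simp: I_def)
  define Z where "Z a w = (\<Sum>t\<in>I. a t * X t w)" for a w
  have Zm: "Z a \<in> borel_measurable M" for a
    unfolding Z_def using I(3) circ by (intro borel_measurable_sum borel_measurable_times) (auto simp: circularly_symmetric_def)
  have Zlin: "(\<lambda>w. Z a w + c * Z b w) = Z (\<lambda>t. a t + c * b t)" for a b c
    by (rule ext) (simp add: Z_def sum.distrib sum_distrib_left ring_distribs mult.assoc)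
  have XZ: "X t = Z (\<lambda>s. if s = t then 1 else 0)" if "t \<in> I" for t
    using that I(1) by (auto simp: Z_def fun_eq_iff if_distrib[of "\<lambda>x. x * _"] cong: if_cong)
  have so': "integrable M (\<lambda>w. (cmod (X t w))\<^sup>2)" "X t \<in> borel_measurable M" if "t \<in> I" for t
    using so I(3)[OF that] by (auto simp: second_order_process_def sq_integrable_def)
  note mom = circularly_symmetric_moments[OF P circ so]
  have XX: "integrable M (\<lambda>w. X t w * X s w)" if "t \<in> I" "s \<in> I" for t s
    using that so' by (intro square_moments_mult_integrable) auto
  have XcX: "integrable M (\<lambda>w. X t w * cnj (X s w))" if "t \<in> I" "s \<in> I" for t s
    using that so' by (intro square_moments_mult_integrable) (auto intro: measurable_compose[OF _ borel_measurable_cnj])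
  have Zint: "integrable M (Z a)" "(\<integral>w. Z a w \<partial>M) = 0" for a
    unfolding Z_def using mom(1,2)[OF I(3) zero_less_one] by simp_all
  have Zsq: "integrable M (\<lambda>w. (cmod (Z a w))\<^sup>2)" for a
  proof -
    have "integrable M (\<lambda>w. Z a w * cnj (Z a w))"
      unfolding Z_def using XcX by (simp add: sum_product mult_ac)
    then show ?thesis
      by (simp only: complex_norm_square[symmetric] complex_of_real_integrable_eq)
  qed
  have Zps: "(\<integral>w. (Z a w)\<^sup>2 \<partial>M) = 0" for a
  proof -
    have "(\<integral>w. (Z a w)\<^sup>2 \<partial>M) = (\<integral>w. (\<Sum>t\<in>I. \<Sum>s\<in>I. a t * a s * (X t w * X s w)) \<partial>M)"
      unfolding Z_def power2_eq_square by (simp add: sum_product mult_ac)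
    also have "\<dots> = (\<Sum>t\<in>I. \<Sum>s\<in>I. a t * a s * (\<integral>w. X t w * X s w \<partial>M))"
      using XX by simp
    also have "\<dots> = 0" using mom(3) I(3) by simp
    finally show ?thesis .
  qed
  have ZG: "gaussian_rv M (\<lambda>w. Re (c * Z a w))" for a c
  proof -
    have "(\<lambda>w. Re (c * Z a w)) = (\<lambda>w. \<Sum>t\<in>I. Re (c * a t) * Re (X t w) + (- Im (c * a t)) * Im (X t w))"
      by (rule ext) (simp add: Z_def sum_distrib_left mult.assoc[symmetric] del: times_complex.sel, simp)
    moreover have "\<And>I a b. finite I \<Longrightarrow> I \<subseteq> {0<..} \<Longrightarrow>
        gaussian_rv M (\<lambda>w. \<Sum>t\<in>I. a t * Re (X t w) + b t * Im (X t w))"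
      using G by (simp add: gaussian_process_def)
    ultimately show ?thesis using I(1,2) by simp
  qed
  note Z4 = circular_gaussian_fourth_moment[OF P Zm ZG Zint(1) Zsq Zint(2) Zps]
  have in_I: "t1 \<in> I" "t2 \<in> I" "s1 \<in> I" "s2 \<in> I" by (auto simp: I_def)
  show ?thesis
    unfolding cov_fun_def
  proof (rule circular_isserlis[where S = "range Z"])
    fix Y W a assume "Y \<in> range Z" "W \<in> range Z"
    then show "(\<lambda>w. Y w + a * W w) \<in> range Z" using Zlin by (auto simp del: range_eqI)
  next
    fix Y assume "Y \<in> range Z"
    then obtain a where Y: "Y = Z a" by blast
    show "Y \<in> borel_measurable M" "integrable M (\<lambda>w. cmod (Y w) ^ 4)"
      "(\<integral>w. (Y w * cnj (Y w))\<^sup>2 \<partial>M) = 2 * (\<integral>w. Y w * cnj (Y w) \<partial>M)\<^sup>2"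
      unfolding Y by (rule Zm Z4)+
  qed (use XZ in_I in blast)+
qed

section \<open>Haar measure of the multiplicative half-line\<close>

text \<open>The dilation-invariant measure dt/t, carried by the positive half-line but defined on
  all reals, so that its measurable sets are the ordinary Borel sets.\<close>

definition haar :: "real measure" where
  "haar = density lborel (\<lambda>t. ennreal (indicator {0<..} t / t))"

lemma sets_haar [measurable_cong, simp]: "sets haar = sets borel"
  by (simp add: haar_def)

lemma space_haar [simp]: "space haar = UNIV"
  by (simp add: haar_def)

lemma sigma_finite_haar: "sigma_finite_measure haar"
  unfolding haar_def
  by (subst sigma_finite_measure.sigma_finite_iff_density_finite[OF lborel.sigma_finite_measure_axioms]) auto

interpretation haar: sigma_finite_measure haar by (rule sigma_finite_haar)
interpretation haar_pair: pair_sigma_finite haar haar ..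

lemma nn_integral_haar:
  assumes [measurable]: "f \<in> borel_measurable borel"
  shows "(\<integral>\<^sup>+t. f t \<partial>haar) = (\<integral>\<^sup>+t. ennreal (indicator {0<..} t / t) * f t \<partial>lborel)"
  unfolding haar_def by (subst nn_integral_density) auto

text \<open>The Jacobian c of the Lebesgue substitution cancels against the density 1/(ct).\<close>

lemma nn_integral_haar_dilate:
  assumes [measurable]: "f \<in> borel_measurable borel" and c: "c > 0"
  shows "(\<integral>\<^sup>+t. f (c * t) \<partial>haar) = (\<integral>\<^sup>+t. f t \<partial>haar)"
proof -
  have *: "ennreal c * (ennreal (indicator {0<..} (c * t) / (c * t)) * y) = ennreal (indicator {0<..} t / t) * y" for t y
    using c by (simp add: mult.assoc[symmetric] ennreal_mult'[symmetric] zero_less_mult_iff split: split_indicator)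
  have "(\<integral>\<^sup>+t. f t \<partial>haar) = ennreal c * (\<integral>\<^sup>+t. ennreal (indicator {0<..} (c * t) / (c * t)) * f (c * t) \<partial>lborel)"
    using c by (subst nn_integral_haar, measurable) (subst nn_integral_real_affine[where c = c and t = 0], auto)
  also have "\<dots> = (\<integral>\<^sup>+t. f (c * t) \<partial>haar)"
    by (subst nn_integral_cmult[symmetric], measurable) (simp add: * nn_integral_haar)
  finally show ?thesis ..
qed

text \<open>\<open>haar\<close> has no mass off the half-line; the substitutions below are valid for
  positive arguments only.\<close>

lemma nn_integral_haar_cong:
  assumes "\<And>t. t > 0 \<Longrightarrow> f t = g t" and "f \<in> borel_measurable borel" "g \<in> borel_measurable borel"
  shows "(\<integral>\<^sup>+t. f t \<partial>haar) = (\<integral>\<^sup>+t. g t \<partial>haar)"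
  using assms by (auto simp: nn_integral_haar intro!: nn_integral_cong split: split_indicator)

text \<open>Both coordinates are changed by dilations only: \<open>t = s v\<close> for fixed \<open>s\<close>, then
  \<open>u = s \<surd>v\<close> for fixed \<open>v\<close>.\<close>

lemma distr_haar_ratio_mean:
  "distr (haar \<Otimes>\<^sub>M haar) (haar \<Otimes>\<^sub>M haar) (\<lambda>(t, s). (t / s, sqrt (t * s))) = haar \<Otimes>\<^sub>M haar"
proof (rule measure_eqI)
  let ?S = "\<lambda>(t, s). (t / s, sqrt (t * s)) :: real \<times> real"
  fix A assume "A \<in> sets (distr (haar \<Otimes>\<^sub>M haar) (haar \<Otimes>\<^sub>M haar) ?S)"
  then have A: "A \<in> sets (haar \<Otimes>\<^sub>M haar)" by simp
  have sb: "sets (haar \<Otimes>\<^sub>M haar) = sets (borel \<Otimes>\<^sub>M borel)" by (intro sets_pair_measure_cong) auto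
  define g :: "real \<times> real \<Rightarrow> ennreal" where "g = indicator A"
  have g: "g \<in> borel_measurable (borel \<Otimes>\<^sub>M borel)" using A unfolding g_def sb by simp
  note [measurable] = g
  have g': "g \<in> borel_measurable (haar \<Otimes>\<^sub>M haar)" using A unfolding g_def by simp
  have S: "?S \<in> measurable (haar \<Otimes>\<^sub>M haar) (haar \<Otimes>\<^sub>M haar)"
    by measurable
  have "emeasure (distr (haar \<Otimes>\<^sub>M haar) (haar \<Otimes>\<^sub>M haar) ?S) A
      = (\<integral>\<^sup>+x. g x \<partial>distr (haar \<Otimes>\<^sub>M haar) (haar \<Otimes>\<^sub>M haar) ?S)"
    using A by (simp add: g_def)
  also have "\<dots> = (\<integral>\<^sup>+x. g (?S x) \<partial>(haar \<Otimes>\<^sub>M haar))"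
    by (rule nn_integral_distr[OF S]) (use g' in simp)
  also have "\<dots> = (\<integral>\<^sup>+s. \<integral>\<^sup>+t. g (t / s, sqrt (t * s)) \<partial>haar \<partial>haar)"
    by (subst haar_pair.nn_integral_snd[symmetric]) (use measurable_compose[OF S g'] in auto)
  also have "\<dots> = (\<integral>\<^sup>+s. \<integral>\<^sup>+v. g (v, s * sqrt v) \<partial>haar \<partial>haar)"
  proof (rule nn_integral_haar_cong)
    fix s :: real assume s: "s > 0"
    have "(\<integral>\<^sup>+t. g (t / s, sqrt (t * s)) \<partial>haar) = (\<integral>\<^sup>+v. g (s * v / s, sqrt (s * v * s)) \<partial>haar)"
      by (rule nn_integral_haar_dilate[symmetric, OF _ s]) measurable
    also have "\<dots> = (\<integral>\<^sup>+v. g (v, s * sqrt v) \<partial>haar)"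
      using s by (intro nn_integral_cong) (simp add: real_sqrt_mult mult_ac)
    finally show "(\<integral>\<^sup>+t. g (t / s, sqrt (t * s)) \<partial>haar) = (\<integral>\<^sup>+v. g (v, s * sqrt v) \<partial>haar)" .
  qed (use haar.borel_measurable_nn_integral in measurable)
  also have "\<dots> = (\<integral>\<^sup>+v. \<integral>\<^sup>+s. g (v, s * sqrt v) \<partial>haar \<partial>haar)"
    by (rule haar_pair.Fubini') measurable
  also have "\<dots> = (\<integral>\<^sup>+v. \<integral>\<^sup>+u. g (v, u) \<partial>haar \<partial>haar)"
  proof (rule nn_integral_haar_cong)
    fix v :: real assume v: "v > 0"
    show "(\<integral>\<^sup>+s. g (v, s * sqrt v) \<partial>haar) = (\<integral>\<^sup>+u. g (v, u) \<partial>haar)"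
      using nn_integral_haar_dilate[of "\<lambda>u. g (v, u)" "sqrt v"] v by (simp add: mult.commute)
  qed measurable
  also have "\<dots> = (\<integral>\<^sup>+x. g x \<partial>(haar \<Otimes>\<^sub>M haar))"
    by (rule haar.nn_integral_fst) (rule g')
  also have "\<dots> = emeasure (haar \<Otimes>\<^sub>M haar) A" using A by (simp add: g_def)
  finally show "emeasure (distr (haar \<Otimes>\<^sub>M haar) (haar \<Otimes>\<^sub>M haar) ?S) A = emeasure (haar \<Otimes>\<^sub>M haar) A" .
qed simp

section \<open>Integrals against \<open>haar\<close> and its square\<close>

lemma integrable_haar_iff:
  fixes f :: "real \<Rightarrow> 'a :: {banach, second_countable_topology}"
  assumes "f \<in> borel_measurable borel"
  shows "integrable haar f \<longleftrightarrow> set_integrable lborel {0<..} (\<lambda>t. f t /\<^sub>R t)"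
  using assms unfolding haar_def set_integrable_def
  by (subst integrable_density)
     (auto intro!: Bochner_Integration.integrable_cong split: split_indicator simp: divide_inverse)

lemma integral_haar_eq:
  fixes f :: "real \<Rightarrow> 'a :: {banach, second_countable_topology}"
  assumes "f \<in> borel_measurable borel"
  shows "(\<integral>t. f t \<partial>haar) = (LINT t:{0<..}|lborel. f t /\<^sub>R t)"
  using assms unfolding haar_def set_lebesgue_integral_def
  by (subst integral_density)
     (auto intro!: Bochner_Integration.integral_cong split: split_indicator simp: divide_inverse)

text \<open>Fubini for a product of functions of one variable. The third identity, for absolute
  values, later controls the double series.\<close>

lemma haar_pair_product:
  fixes m n :: "real \<Rightarrow> complex"
  assumes m: "integrable haar m" and n: "integrable haar n"
  shows "integrable (haar \<Otimes>\<^sub>M haar) (\<lambda>(t, s). m t * n s)"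
    and "(\<integral>(t, s). m t * n s \<partial>(haar \<Otimes>\<^sub>M haar)) = (\<integral>t. m t \<partial>haar) * (\<integral>s. n s \<partial>haar)"
    and "(\<integral>x. cmod (case x of (t, s) \<Rightarrow> m t * n s) \<partial>(haar \<Otimes>\<^sub>M haar)) = (\<integral>t. cmod (m t) \<partial>haar) * (\<integral>s. cmod (n s) \<partial>haar)"
proof -
  note [measurable] = borel_measurable_integrable[OF m] borel_measurable_integrable[OF n]
  show I: "integrable (haar \<Otimes>\<^sub>M haar) (\<lambda>(t, s). m t * n s)"
    by (rule haar_pair.Fubini_integrable) (use m n in \<open>auto simp: norm_mult\<close>)
  show "(\<integral>(t, s). m t * n s \<partial>(haar \<Otimes>\<^sub>M haar)) = (\<integral>t. m t \<partial>haar) * (\<integral>s. n s \<partial>haar)"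
    by (subst haar_pair.integral_fst'[OF I, symmetric]) simp
  show "(\<integral>x. cmod (case x of (t, s) \<Rightarrow> m t * n s) \<partial>(haar \<Otimes>\<^sub>M haar)) = (\<integral>t. cmod (m t) \<partial>haar) * (\<integral>s. cmod (n s) \<partial>haar)"
    by (subst haar_pair.integral_fst'[OF integrable_norm[OF I], symmetric]) (simp add: norm_mult)
qed

text \<open>The ratio and geometric-mean coordinates preserve the product measure, so everything
  follows from \<open>haar_pair_product\<close> by composition.\<close>

lemma haar_pair_ratio_mean:
  fixes m n :: "real \<Rightarrow> complex"
  assumes m: "integrable haar m" and n: "integrable haar n"
  shows "integrable (haar \<Otimes>\<^sub>M haar) (\<lambda>(t, s). m (t / s) * n (sqrt (t * s)))"
    and "(\<integral>(t, s). m (t / s) * n (sqrt (t * s)) \<partial>(haar \<Otimes>\<^sub>M haar)) = (\<integral>t. m t \<partial>haar) * (\<integral>s. n s \<partial>haar)"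
    and "(\<integral>x. cmod (case x of (t, s) \<Rightarrow> m (t / s) * n (sqrt (t * s))) \<partial>(haar \<Otimes>\<^sub>M haar)) = (\<integral>t. cmod (m t) \<partial>haar) * (\<integral>s. cmod (n s) \<partial>haar)"
proof -
  let ?S = "\<lambda>(t, s). (t / s, sqrt (t * s)) :: real \<times> real"
  let ?f = "\<lambda>(t, s). m t * n s"
  have S: "?S \<in> measurable (haar \<Otimes>\<^sub>M haar) (haar \<Otimes>\<^sub>M haar)" by measurable
  note I = haar_pair_product[OF m n]
  have f: "?f \<in> borel_measurable (haar \<Otimes>\<^sub>M haar)" using I(1) by (rule borel_measurable_integrable)
  have e: "?f (?S x) = (case x of (t, s) \<Rightarrow> m (t / s) * n (sqrt (t * s)))" for x by (simp split: prod.split)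
  show "integrable (haar \<Otimes>\<^sub>M haar) (\<lambda>(t, s). m (t / s) * n (sqrt (t * s)))"
    using integrable_distr[OF S, of ?f] I(1) unfolding distr_haar_ratio_mean e by simp
  show "(\<integral>(t, s). m (t / s) * n (sqrt (t * s)) \<partial>(haar \<Otimes>\<^sub>M haar)) = (\<integral>t. m t \<partial>haar) * (\<integral>s. n s \<partial>haar)"
    using integral_distr[OF S f] I(2) unfolding distr_haar_ratio_mean e by simp
  show "(\<integral>x. cmod (case x of (t, s) \<Rightarrow> m (t / s) * n (sqrt (t * s))) \<partial>(haar \<Otimes>\<^sub>M haar)) = (\<integral>t. cmod (m t) \<partial>haar) * (\<integral>s. cmod (n s) \<partial>haar)"
    using integral_distr[OF S measurable_compose[OF f borel_measurable_norm]] I(3) unfolding distr_haar_ratio_mean e by simp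
qed

section \<open>Locally self-similar covariances and their series\<close>

text \<open>Both symmetries come from the Hermitian symmetry of a covariance. On the diagonal, where
  \<open>C 1 = 1\<close>, it says that Q is real; off the diagonal it relates C at v and
  1/v.\<close>

lemma lss_covariance_properties:
  assumes "lss_covariance Q C"
  shows "continuous_on {0<..} Q" "continuous_on {0<..} C"
    and "t > 0 \<Longrightarrow> cnj (Q t) = Q t"
    and "v > 0 \<Longrightarrow> C (1 / v) = cnj (C v)"
proof -
  obtain N :: "(real \<Rightarrow> complex) measure" and Y where "locally_self_similar N Y Q C"
    using assms by (auto simp: lss_covariance_def)
  then have cont: "continuous_on {0<..} Q" "continuous_on {0<..} C"
    and cov: "\<And>t s. t > 0 \<Longrightarrow> s > 0 \<Longrightarrow> cov_fun N Y t s = Q (sqrt (t * s)) * C (t / s)"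
    and C1: "C 1 = 1" and ex: "\<exists>t>0. Q t \<noteq> 0"
    by (auto simp: locally_self_similar_def)
  have herm: "cov_fun N Y s t = cnj (cov_fun N Y t s)" for t s
    unfolding cov_fun_def Bochner_Integration.integral_cnj[symmetric] by (simp add: mult.commute)
  show "continuous_on {0<..} Q" "continuous_on {0<..} C" by fact+
  show real: "cnj (Q t) = Q t" if "t > 0" for t
    using herm[of t t] cov[of t t] that C1 by simp
  show "C (1 / v) = cnj (C v)" if v: "v > 0"
  proof -
    obtain u where u: "u > 0" "Q u \<noteq> 0" using ex by blast
    \<comment> \<open>The times u sqrt(v) and u / sqrt(v) have geometric mean u and ratio v. As
      \<open>Q u\<close> is real and nonzero, it can be cancelled from the symmetry
      relation.\<close>
    have 1: "(u * sqrt v) * (u / sqrt v) = u\<^sup>2" "u * sqrt v / (u / sqrt v) = v"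
      "u / sqrt v / (u * sqrt v) = 1 / v"
      using u v by (simp_all add: field_simps power2_eq_square)
    have "cov_fun N Y (u / sqrt v) (u * sqrt v) = Q u * C (1 / v)"
      "cov_fun N Y (u * sqrt v) (u / sqrt v) = Q u * C v"
      using cov[of "u / sqrt v" "u * sqrt v"] cov[of "u * sqrt v" "u / sqrt v"] u v 1
      by (simp_all add: mult.commute)
    then show ?thesis
      using herm[of "u / sqrt v" "u * sqrt v"] u real[OF u(1)] by simp
  qed
qed

text \<open>Absolute convergence makes the product of two series a sum over pairs that may be taken
  in any order. Enumerating the pairs by \<open>prod_decode\<close> gives an ordinary series, the
  form in which termwise integration is available.\<close>

lemma suminf_product_prod_decode:
  fixes a b :: "nat \<Rightarrow> complex"
  assumes a: "summable (\<lambda>j. norm (a j))" and b: "summable (\<lambda>k. norm (b k))"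
  shows "summable (\<lambda>n. norm (case prod_decode n of (j, k) \<Rightarrow> a j * b k))"
    and "(\<Sum>n. case prod_decode n of (j, k) \<Rightarrow> a j * b k) = (\<Sum>j. a j) * (\<Sum>k. b k)"
proof -
  have ab: "Infinite_Set_Sum.abs_summable_on a UNIV" "Infinite_Set_Sum.abs_summable_on b UNIV" using a b by (simp_all add: abs_summable_on_nat_iff')
  have "Infinite_Set_Sum.abs_summable_on (\<lambda>(j, k). a j * b k) (UNIV \<times> UNIV)"
    using ab by (intro abs_summable_on_product) auto
  then have s: "Infinite_Set_Sum.abs_summable_on (\<lambda>n. case prod_decode n of (j, k) \<Rightarrow> a j * b k) UNIV"
    using abs_summable_on_reindex_bij_betw[OF bij_prod_decode, of "\<lambda>(j, k). a j * b k"] by simp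
  then show 1: "summable (\<lambda>n. norm (case prod_decode n of (j, k) \<Rightarrow> a j * b k))"
    by (simp add: abs_summable_on_nat_iff')
  have "(\<Sum>n. case prod_decode n of (j, k) \<Rightarrow> a j * b k) = (\<Sum>\<^sub>an. case prod_decode n of (j, k) \<Rightarrow> a j * b k)"
    using s by (simp add: infsetsum_nat')
  also have "\<dots> = (\<Sum>\<^sub>a(j, k)\<in>UNIV \<times> UNIV. a j * b k)"
    using infsetsum_reindex_bij_betw[OF bij_prod_decode, of "\<lambda>(j, k). a j * b k"] by simp
  also have "\<dots> = (\<Sum>j. a j) * (\<Sum>k. b k)"
    using ab by (subst infsetsum_product) (auto simp: infsetsum_nat')
  finally show "(\<Sum>n. case prod_decode n of (j, k) \<Rightarrow> a j * b k) = (\<Sum>j. a j) * (\<Sum>k. b k)" .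
qed

section \<open>Mellin transforms and convolutions as Haar integrals\<close>

definition mchar :: "real \<Rightarrow> real \<Rightarrow> complex" where
  "mchar \<theta> t = cis (- (2 * pi * \<theta>) * ln t)"

lemma mchar_measurable [measurable]: "mchar \<theta> \<in> borel_measurable borel"
proof -
  have "cis \<in> borel_measurable borel" by (intro borel_measurable_continuous_onI continuous_intros)
  moreover have "(\<lambda>t. - (2 * pi * \<theta>) * ln t) \<in> borel_measurable borel" by measurable
  ultimately show ?thesis unfolding mchar_def by (rule measurable_compose[rotated])
qed

lemma norm_mchar [simp]: "norm (mchar \<theta> t) = 1"
  by (simp add: mchar_def)

lemma mchar_divide: "t > 0 \<Longrightarrow> s > 0 \<Longrightarrow> mchar \<theta> (t / s) = mchar \<theta> t * cnj (mchar \<theta> s)"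
  by (simp only: mchar_def ln_div cis_cnj cis_mult) (rule arg_cong[of _ _ cis], simp add: algebra_simps)

text \<open>On the imaginary axis the Mellin kernel is a unitary character of the multiplicative
  group times the density of \<open>haar\<close>.\<close>

lemma powr_eq_mchar:
  assumes "t > 0"
  shows "of_real t powr (- (\<i> * of_real (2 * pi * \<theta>)) - 1) = mchar \<theta> t /\<^sub>R t"
proof -
  let ?w = "- (\<i> * of_real (2 * pi * \<theta>)) :: complex"
  have "of_real t powr (?w - 1) = exp ((?w - 1) * of_real (ln t))"
    using assms by (simp only: powr_def Ln_of_real of_real_eq_0_iff) simp
  also have "\<dots> = exp (?w * of_real (ln t)) / of_real t"
    by (simp only: left_diff_distrib mult_1 exp_diff exp_of_real exp_ln[OF assms])
  also have "exp (?w * of_real (ln t)) = mchar \<theta> t"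
    unfolding mchar_def cis_conv_exp by (rule arg_cong[of _ _ exp]) simp
  finally show ?thesis by (simp add: scaleR_conv_of_real divide_inverse mult.commute)
qed

text \<open>Measurability is asked of f, which has to agree with g times the character for positive
  arguments only. Zero extensions of functions continuous on the half-line can thus stand in for
  them.\<close>

lemma mellin_haar:
  assumes [measurable]: "f \<in> borel_measurable borel" and eq: "\<And>t. t > 0 \<Longrightarrow> f t = g t * mchar \<theta> t"
  shows "integrable haar f \<longleftrightarrow> mellin_integrable g (\<i> * of_real (2 * pi * \<theta>))"
    and "(\<integral>t. f t \<partial>haar) = mellin g (\<i> * of_real (2 * pi * \<theta>))"
    and "(\<integral>t. cmod (f t) \<partial>haar) = mellin_abs g (\<i> * of_real (2 * pi * \<theta>))"
proof -
  have *: "f t /\<^sub>R t = g t * of_real t powr (- (\<i> * of_real (2 * pi * \<theta>)) - 1)" if "t > 0" for t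
    using eq[OF that] by (simp only: powr_eq_mchar[OF that]) simp
  show "integrable haar f \<longleftrightarrow> mellin_integrable g (\<i> * of_real (2 * pi * \<theta>))"
    unfolding integrable_haar_iff[OF assms(1)] mellin_integrable_def
    by (intro set_integrable_cong) (auto simp only: * greaterThan_iff)
  show "(\<integral>t. f t \<partial>haar) = mellin g (\<i> * of_real (2 * pi * \<theta>))"
    unfolding integral_haar_eq[OF assms(1)] mellin_def
    by (intro set_lebesgue_integral_cong) (auto simp only: * greaterThan_iff sets_lborel borel_open open_greaterThan)
  have "(\<integral>t. cmod (f t) \<partial>haar) = (LINT t:{0<..}|lborel. cmod (f t) /\<^sub>R t)"
    by (rule integral_haar_eq) measurable
  also have "\<dots> = mellin_abs g (\<i> * of_real (2 * pi * \<theta>))"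
    unfolding mellin_abs_def
  proof (intro set_lebesgue_integral_cong allI impI)
    fix t :: real assume "t \<in> {0<..}"
    then show "cmod (f t) /\<^sub>R t = cmod (g t * of_real t powr (- (\<i> * of_real (2 * pi * \<theta>)) - 1))"
      by (subst *[symmetric]) simp_all
  qed simp
  finally show "(\<integral>t. cmod (f t) \<partial>haar) = mellin_abs g (\<i> * of_real (2 * pi * \<theta>))" .
qed

lemma mconv_haar:
  assumes [measurable]: "h \<in> borel_measurable borel" and eq: "\<And>u. u > 0 \<Longrightarrow> h u = f (u * sqrt \<tau>) * g (u / sqrt \<tau>)"
  shows "integrable haar h \<longleftrightarrow> mconv_integrable f g \<tau>"
    and "(\<integral>u. h u \<partial>haar) = mconv f g \<tau>"
    and "(\<integral>u. cmod (h u) \<partial>haar) = mconv_abs f g \<tau>"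
proof -
  have *: "h u /\<^sub>R u = f (u * sqrt \<tau>) * g (u / sqrt \<tau>) / of_real u" if "u > 0" for u
    using eq[OF that] by (simp add: scaleR_conv_of_real divide_inverse mult_ac)
  show "integrable haar h \<longleftrightarrow> mconv_integrable f g \<tau>"
    unfolding integrable_haar_iff[OF assms(1)] mconv_integrable_def
    by (intro set_integrable_cong) (auto simp only: * greaterThan_iff)
  show "(\<integral>u. h u \<partial>haar) = mconv f g \<tau>"
    unfolding integral_haar_eq[OF assms(1)] mconv_def
    by (intro set_lebesgue_integral_cong) (auto simp only: * greaterThan_iff sets_lborel borel_open open_greaterThan)
  have "(\<integral>u. cmod (h u) \<partial>haar) = (LINT u:{0<..}|lborel. cmod (h u) /\<^sub>R u)"
    by (rule integral_haar_eq) measurable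
  also have "\<dots> = mconv_abs f g \<tau>"
    unfolding mconv_abs_def
  proof (intro set_lebesgue_integral_cong allI impI)
    fix u :: real assume "u \<in> {0<..}"
    then show "cmod (h u) /\<^sub>R u = cmod (f (u * sqrt \<tau>) * g (u / sqrt \<tau>) / of_real u)"
      by (subst *[symmetric]) simp_all
  qed simp
  finally show "(\<integral>u. cmod (h u) \<partial>haar) = mconv_abs f g \<tau>" .
qed

section \<open>Deterministic integrals of the covariance series at a fixed point\<close>

locale lss_family =
  fixes Q C :: "nat \<Rightarrow> real \<Rightarrow> complex" and \<theta> \<tau> :: real
  assumes tau: "\<tau> > 0"
    and cont_Q: "\<And>j. continuous_on {0<..} (Q j)"
    and cont_C: "\<And>j. continuous_on {0<..} (C j)"
    and Q_real: "\<And>j t. t > 0 \<Longrightarrow> cnj (Q j t) = Q j t"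
    and C_herm: "\<And>j v. v > 0 \<Longrightarrow> C j (1 / v) = cnj (C j v)"
    and abs_cov: "\<And>t s. t > 0 \<Longrightarrow> s > 0 \<Longrightarrow> summable (\<lambda>j. cmod (Q j (sqrt (t * s)) * C j (t / s)))"
    and abs_mellin_Q: "\<And>j. mellin_integrable (Q j) (\<i> * of_real (2 * pi * \<theta>))"
    and abs_mellin_C: "\<And>j k. mellin_integrable (\<lambda>v. C j v * cnj (C k v)) (\<i> * of_real (2 * pi * \<theta>))"
    and abs_mconv: "\<And>j k. mconv_integrable (Q j) (\<lambda>u. cnj (Q k u)) \<tau>"
    and abs_single: "summable (\<lambda>j. cmod (C j \<tau>) * mellin_abs (Q j) (\<i> * of_real (2 * pi * \<theta>)))"
    and abs_double: "(\<lambda>(j, k). mellin_abs (\<lambda>v. C j v * cnj (C k v)) (\<i> * of_real (2 * pi * \<theta>))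
                     * mconv_abs (Q j) (\<lambda>u. cnj (Q k u)) \<tau>) summable_on UNIV"
begin

definition "R t s = (\<Sum>j. Q j (sqrt (t * s)) * C j (t / s))"

text \<open>Continuity is only given on the half-line, so measurability needs the extension by \<open>0\<close>.\<close>

definition "Qp j t = indicator {0<..} t *\<^sub>R Q j t"
definition "Cp j t = indicator {0<..} t *\<^sub>R C j t"

lemma Qp_Cp_measurable [measurable]: "Qp j \<in> borel_measurable borel" "Cp j \<in> borel_measurable borel"
  unfolding Qp_def[abs_def] Cp_def[abs_def]
  by (auto intro!: borel_measurable_continuous_on_indicator cont_Q cont_C)

lemma Qp_Cp_pos [simp]: "t > 0 \<Longrightarrow> Qp j t = Q j t" "t > 0 \<Longrightarrow> Cp j t = C j t"
  by (simp_all add: Qp_def Cp_def)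

lemma Qp_Cp_nonpos [simp]: "t \<le> 0 \<Longrightarrow> Qp j t = 0" "t \<le> 0 \<Longrightarrow> Cp j t = 0"
  by (simp_all add: Qp_def Cp_def)

text \<open>Densities against \<open>haar\<close>: \<open>q j\<close> is the j-th term of the
  integrand of E A_X, while \<open>m j k\<close> and \<open>n j k\<close> are the ratio factor and
  the geometric-mean factor of the (j,k) term in the second Isserlis product.\<close>

definition "q j t = C j \<tau> * (Qp j t * mchar \<theta> t)"
definition "m j k v = Cp j v * cnj (Cp k v) * mchar \<theta> v"
definition "n j k u = Qp j (u * sqrt \<tau>) * cnj (Qp k (u / sqrt \<tau>))"

lemma qmn_measurable [measurable]: "q j \<in> borel_measurable borel"
  "m j k \<in> borel_measurable borel" "n j k \<in> borel_measurable borel"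
  unfolding q_def[abs_def] m_def[abs_def] n_def[abs_def] by measurable

lemma q_integral: "integrable haar (q j)" "(\<integral>t. q j t \<partial>haar) = C j \<tau> * mellin (Q j) (\<i> * of_real (2 * pi * \<theta>))"
  "(\<integral>t. cmod (q j t) \<partial>haar) = cmod (C j \<tau>) * mellin_abs (Q j) (\<i> * of_real (2 * pi * \<theta>))"
proof -
  have M: "(\<lambda>t. Qp j t * mchar \<theta> t) \<in> borel_measurable borel" by measurable
  note I = mellin_haar[OF M, where g = "Q j" and \<theta> = \<theta>]
  show "integrable haar (q j)" "(\<integral>t. q j t \<partial>haar) = C j \<tau> * mellin (Q j) (\<i> * of_real (2 * pi * \<theta>))"
    "(\<integral>t. cmod (q j t) \<partial>haar) = cmod (C j \<tau>) * mellin_abs (Q j) (\<i> * of_real (2 * pi * \<theta>))"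
    unfolding q_def[abs_def] norm_mult[of "C j \<tau>"]
    using I abs_mellin_Q[of j] by simp_all
qed

lemma m_integral: "integrable haar (m j k)"
  "(\<integral>t. m j k t \<partial>haar) = mellin (\<lambda>v. C j v * cnj (C k v)) (\<i> * of_real (2 * pi * \<theta>))"
  "(\<integral>t. cmod (m j k t) \<partial>haar) = mellin_abs (\<lambda>v. C j v * cnj (C k v)) (\<i> * of_real (2 * pi * \<theta>))"
proof -
  have e: "m j k v = C j v * cnj (C k v) * mchar \<theta> v" if "v > 0" for v using that by (simp add: m_def)
  note I = mellin_haar[of "m j k" "\<lambda>v. C j v * cnj (C k v)" \<theta>, OF _ e]
  show "integrable haar (m j k)"
    "(\<integral>t. m j k t \<partial>haar) = mellin (\<lambda>v. C j v * cnj (C k v)) (\<i> * of_real (2 * pi * \<theta>))"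
    "(\<integral>t. cmod (m j k t) \<partial>haar) = mellin_abs (\<lambda>v. C j v * cnj (C k v)) (\<i> * of_real (2 * pi * \<theta>))"
    using I abs_mellin_C[of j k] by (simp_all only: qmn_measurable)
qed

lemma n_integral: "integrable haar (n j k)"
  "(\<integral>t. n j k t \<partial>haar) = mconv (Q j) (\<lambda>u. cnj (Q k u)) \<tau>"
  "(\<integral>t. cmod (n j k t) \<partial>haar) = mconv_abs (Q j) (\<lambda>u. cnj (Q k u)) \<tau>"
proof -
  have e: "n j k u = Q j (u * sqrt \<tau>) * cnj (Q k (u / sqrt \<tau>))" if "u > 0" for u
    using that tau by (simp add: n_def)
  note I = mconv_haar[of "n j k" "Q j" \<tau> "\<lambda>u. cnj (Q k u)", OF _ e]
  show "integrable haar (n j k)"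
    "(\<integral>t. n j k t \<partial>haar) = mconv (Q j) (\<lambda>u. cnj (Q k u)) \<tau>"
    "(\<integral>t. cmod (n j k t) \<partial>haar) = mconv_abs (Q j) (\<lambda>u. cnj (Q k u)) \<tau>"
    using I abs_mconv[of j k] by (simp_all only: qmn_measurable)
qed

definition "A = (\<Sum>j. C j \<tau> * mellin (Q j) (\<i> * of_real (2 * pi * \<theta>)))"
definition "g t = (\<Sum>j. q j t)"

lemma ambiguity_args:
  assumes "t > 0"
  shows "sqrt (t * sqrt \<tau> * (t / sqrt \<tau>)) = t" "t * sqrt \<tau> / (t / sqrt \<tau>) = \<tau>"
proof -
  have "t * sqrt \<tau> * (t / sqrt \<tau>) = t * t" using tau by simp
  then show "sqrt (t * sqrt \<tau> * (t / sqrt \<tau>)) = t" using assms by simp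
  show "t * sqrt \<tau> / (t / sqrt \<tau>) = \<tau>" using assms tau by simp
qed

lemma summable_Q:
  assumes "t > 0" shows "summable (\<lambda>j. cmod (Q j t * C j \<tau>))"
proof -
  have "t * sqrt \<tau> > 0" "t / sqrt \<tau> > 0" using assms tau by simp_all
  from abs_cov[OF this] show ?thesis unfolding ambiguity_args[OF assms] .
qed

text \<open>The zero extension covers nonpositive t, so the series converges absolutely at every
  real point.\<close>

lemma summable_q: "summable (\<lambda>j. cmod (q j t))"
proof (cases "t > 0")
  case True
  then have "cmod (q j t) = cmod (Q j t * C j \<tau>)" for j
    by (simp add: q_def norm_mult)
  then show ?thesis using summable_Q[OF True] by simp
qed (simp add: q_def)

lemma g_eq:
  assumes "t > 0" shows "g t = R (t * sqrt \<tau>) (t / sqrt \<tau>) * mchar \<theta> t"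
proof -
  have "q j t = Q j t * C j \<tau> * mchar \<theta> t" for j
    using assms by (simp add: q_def)
  then show ?thesis
    unfolding g_def R_def ambiguity_args[OF assms]
    using suminf_mult2[OF summable_norm_cancel[OF summable_Q[OF assms]]] by simp
qed

text \<open>Termwise integration: by \<open>abs_single\<close> the sum of the integrals of |q_j| is
  finite.\<close>

lemma g_integral: "integrable haar g" "(\<integral>t. g t \<partial>haar) = A"
  unfolding g_def[abs_def] A_def q_integral(2)[symmetric]
  using summable_q abs_single
  by (auto intro!: integrable_suminf integral_suminf q_integral(1) simp: q_integral(3))

definition "f i = (case prod_decode i of (j, k) \<Rightarrow> \<lambda>(t, s). m j k (t / s) * n j k (sqrt (t * s)))"

lemma f_integral:
  assumes "prod_decode i = (j, k)"
  shows "integrable (haar \<Otimes>\<^sub>M haar) (f i)"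
    "integral\<^sup>L (haar \<Otimes>\<^sub>M haar) (f i) = mellin (\<lambda>v. C j v * cnj (C k v)) (\<i> * of_real (2 * pi * \<theta>))
        * mconv (Q j) (\<lambda>u. cnj (Q k u)) \<tau>"
    "(\<integral>x. cmod (f i x) \<partial>(haar \<Otimes>\<^sub>M haar)) = mellin_abs (\<lambda>v. C j v * cnj (C k v)) (\<i> * of_real (2 * pi * \<theta>))
        * mconv_abs (Q j) (\<lambda>u. cnj (Q k u)) \<tau>"
proof -
  have f: "f i = (\<lambda>(t, s). m j k (t / s) * n j k (sqrt (t * s)))" by (simp add: f_def assms)
  show "integrable (haar \<Otimes>\<^sub>M haar) (f i)"
    "integral\<^sup>L (haar \<Otimes>\<^sub>M haar) (f i) = mellin (\<lambda>v. C j v * cnj (C k v)) (\<i> * of_real (2 * pi * \<theta>))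
        * mconv (Q j) (\<lambda>u. cnj (Q k u)) \<tau>"
    "(\<integral>x. cmod (f i x) \<partial>(haar \<Otimes>\<^sub>M haar)) = mellin_abs (\<lambda>v. C j v * cnj (C k v)) (\<i> * of_real (2 * pi * \<theta>))
        * mconv_abs (Q j) (\<lambda>u. cnj (Q k u)) \<tau>"
    unfolding f using haar_pair_ratio_mean[OF m_integral(1) n_integral(1), of j k j k]
    by (simp_all only: m_integral n_integral)
qed

text \<open>The times t sqrt(\<tau>), s sqrt(\<tau>) have ratio t/s, and s / sqrt(\<tau>), t /
  sqrt(\<tau>) have the inverse ratio. Both covariance series are therefore series in the same two
  coordinates, and their product is the double series.\<close>

lemma f_pointwise:
  assumes t: "t > 0" and s: "s > 0"
  shows "summable (\<lambda>i. cmod (f i (t, s)))"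
    and "(\<Sum>i. f i (t, s)) = R (t * sqrt \<tau>) (s * sqrt \<tau>) * R (s / sqrt \<tau>) (t / sqrt \<tau>) * mchar \<theta> (t / s)"
proof -
  define a where "a j = Q j (sqrt (t * s) * sqrt \<tau>) * C j (t / s) * mchar \<theta> (t / s)" for j
  define b where "b k = cnj (Q k (sqrt (t * s) / sqrt \<tau>)) * cnj (C k (t / s))" for k
  have eq: "f i (t, s) = (case prod_decode i of (j, k) \<Rightarrow> a j * b k)" for i
    using t s tau by (simp add: f_def m_def n_def a_def b_def mult_ac split: prod.split)
  have a1: "sqrt (t * sqrt \<tau> * (s * sqrt \<tau>)) = sqrt (t * s) * sqrt \<tau>" "t * sqrt \<tau> / (s * sqrt \<tau>) = t / s"
    using t s tau by (simp_all add: real_sqrt_mult)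
  have b1: "sqrt (s / sqrt \<tau> * (t / sqrt \<tau>)) = sqrt (t * s) / sqrt \<tau>" "s / sqrt \<tau> / (t / sqrt \<tau>) = 1 / (t / s)"
    using t s tau by (simp_all add: real_sqrt_mult real_sqrt_divide)
  \<comment> \<open>\<open>C_herm\<close> replaces the inverse ratio by a conjugate, and the reality
    of Q allows its factor to be conjugated as well.\<close>
  have b2: "Q k (sqrt (s / sqrt \<tau> * (t / sqrt \<tau>))) * C k (s / sqrt \<tau> / (t / sqrt \<tau>)) = b k" for k
    unfolding b1 b_def using C_herm[of "t / s" k] Q_real[of "sqrt (t * s) / sqrt \<tau>" k] t s tau by simp
  have sa: "summable (\<lambda>j. cmod (Q j (sqrt (t * s) * sqrt \<tau>) * C j (t / s)))"
    using abs_cov[of "t * sqrt \<tau>" "s * sqrt \<tau>"] t s tau unfolding a1 by simp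
  then have sa': "summable (\<lambda>j. cmod (a j))" by (simp add: a_def norm_mult)
  have sb: "summable (\<lambda>k. cmod (b k))"
    using abs_cov[of "s / sqrt \<tau>" "t / sqrt \<tau>"] t s tau unfolding b2 by simp
  note ab = suminf_product_prod_decode[OF sa' sb]
  show "summable (\<lambda>i. cmod (f i (t, s)))" unfolding eq by (rule ab)
  have "(\<Sum>j. a j) = R (t * sqrt \<tau>) (s * sqrt \<tau>) * mchar \<theta> (t / s)"
    unfolding R_def a1 a_def by (rule suminf_mult2[symmetric, OF summable_norm_cancel[OF sa]])
  moreover have "(\<Sum>k. b k) = R (s / sqrt \<tau>) (t / sqrt \<tau>)"
    unfolding R_def b2 ..
  ultimately show "(\<Sum>i. f i (t, s)) = R (t * sqrt \<tau>) (s * sqrt \<tau>) * R (s / sqrt \<tau>) (t / sqrt \<tau>) * mchar \<theta> (t / s)"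
    unfolding eq ab(2) by (simp add: mult_ac)
qed

text \<open>For t/s > 0 both numbers may be replaced by their absolute values, since the ratio and
  the product do not change. Otherwise, including s = 0 where the quotient is 0, the factor
  \<open>m\<close> vanishes.\<close>

lemma summable_f: "summable (\<lambda>i. cmod (f i x))"
proof -
  obtain t s where x: "x = (t, s)" by fastforce
  show ?thesis
  proof (cases "t / s > 0")
    case True
    then have "f i x = f i (\<bar>t\<bar>, \<bar>s\<bar>)" for i
      unfolding x f_def by (auto simp: zero_less_divide_iff abs_if split: prod.split)
    moreover have "summable (\<lambda>i. cmod (f i (\<bar>t\<bar>, \<bar>s\<bar>)))"
      using True by (intro f_pointwise) auto
    ultimately show ?thesis by simp
  next
    case False
    then have "f i x = 0" for i unfolding x f_def by (simp add: m_def not_less split: prod.split)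
    then show ?thesis by simp
  qed
qed

text \<open>By \<open>f_integral\<close> these norms are exactly the terms of
  \<open>abs_double\<close>, enumerated by \<open>prod_decode\<close>.\<close>

lemma summable_f_integral: "summable (\<lambda>i. \<integral>x. cmod (f i x) \<partial>(haar \<Otimes>\<^sub>M haar))"
proof -
  let ?h = "\<lambda>(j, k). mellin_abs (\<lambda>v. C j v * cnj (C k v)) (\<i> * of_real (2 * pi * \<theta>))
                     * mconv_abs (Q j) (\<lambda>u. cnj (Q k u)) \<tau>"
  have "(\<lambda>i. ?h (prod_decode i)) summable_on UNIV"
    using abs_double summable_on_reindex_bij_betw[OF bij_prod_decode, of ?h] by simp
  moreover have "?h (prod_decode i) = (\<integral>x. cmod (f i x) \<partial>(haar \<Otimes>\<^sub>M haar))" for i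
    by (cases "prod_decode i") (simp add: f_integral(3))
  ultimately show ?thesis using summable_on_imp_summable by simp
qed

definition "B = (\<Sum>\<^sub>\<infinity>(j, k)\<in>UNIV. mellin (\<lambda>v. C j v * cnj (C k v)) (\<i> * of_real (2 * pi * \<theta>))
                          * mconv (Q j) (\<lambda>u. cnj (Q k u)) \<tau>)"

lemma F_integral: "integrable (haar \<Otimes>\<^sub>M haar) (\<lambda>x. \<Sum>i. f i x)"
  "(\<integral>x. (\<Sum>i. f i x) \<partial>(haar \<Otimes>\<^sub>M haar)) = B"
proof -
  have I: "integrable (haar \<Otimes>\<^sub>M haar) (f i)" for i by (cases "prod_decode i") (rule f_integral)
  have S: "AE x in haar \<Otimes>\<^sub>M haar. summable (\<lambda>i. cmod (f i x))" using summable_f by simp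
  show "integrable (haar \<Otimes>\<^sub>M haar) (\<lambda>x. \<Sum>i. f i x)"
    by (rule integrable_suminf[OF I S summable_f_integral])
  let ?h = "\<lambda>(j, k). mellin (\<lambda>v. C j v * cnj (C k v)) (\<i> * of_real (2 * pi * \<theta>))
                          * mconv (Q j) (\<lambda>u. cnj (Q k u)) \<tau>"
  have h: "?h (prod_decode i) = integral\<^sup>L (haar \<Otimes>\<^sub>M haar) (f i)" for i
    by (cases "prod_decode i") (simp add: f_integral(2))
  \<comment> \<open>Absolute summability turns the ordered series of integrals into an unordered
    sum, which can be reindexed back to pairs.\<close>
  have "summable (\<lambda>i. cmod (integral\<^sup>L (haar \<Otimes>\<^sub>M haar) (f i)))"
    by (rule summable_comparison_test'[OF summable_f_integral]) simp
  then have "((\<lambda>i. integral\<^sup>L (haar \<Otimes>\<^sub>M haar) (f i)) has_sum (\<integral>x. (\<Sum>i. f i x) \<partial>(haar \<Otimes>\<^sub>M haar))) UNIV"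
    by (rule norm_summable_imp_has_sum[OF _ sums_integral[OF I S summable_f_integral]])
  then have "(?h has_sum (\<integral>x. (\<Sum>i. f i x) \<partial>(haar \<Otimes>\<^sub>M haar))) UNIV"
    unfolding h[symmetric] by (subst (asm) has_sum_reindex_bij_betw[OF bij_prod_decode])
  then show "(\<integral>x. (\<Sum>i. f i x) \<partial>(haar \<Otimes>\<^sub>M haar)) = B" unfolding B_def by (rule infsumI[symmetric])
qed

lemma mean_integral:
  "(LINT t:{0<..}|lborel. R (t * sqrt \<tau>) (t / sqrt \<tau>)
      * of_real t powr (- (\<i> * of_real (2 * pi * \<theta>)) - 1)) = A"
proof -
  have "A = (LINT t:{0<..}|lborel. g t /\<^sub>R t)"
    using g_integral(2) integral_haar_eq[of g] borel_measurable_integrable[OF g_integral(1)]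
    by (simp cong: measurable_cong_sets)
  also have "\<dots> = (LINT t:{0<..}|lborel. R (t * sqrt \<tau>) (t / sqrt \<tau>)
      * of_real t powr (- (\<i> * of_real (2 * pi * \<theta>)) - 1))"
    by (intro set_lebesgue_integral_cong allI impI) (simp_all only: greaterThan_iff powr_eq_mchar g_eq mult_scaleR_right sets_lborel borel_open open_greaterThan)
  finally show ?thesis ..
qed

text \<open>The integrand is a density G on the square of \<open>haar\<close>: the first product
  separates into \<open>g t * cnj (g s)\<close> and integrates to |A|^2, the second is the double
  series and integrates to B. Conjugating the kernel at s turns the two characters into
  \<open>mchar\<close> at t/s.\<close>

lemma power_integral:
  "(LINT t:{0<..}|lborel. (LINT s:{0<..}|lborel.
      (R (t * sqrt \<tau>) (t / sqrt \<tau>) * cnj (R (s * sqrt \<tau>) (s / sqrt \<tau>))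
        + R (t * sqrt \<tau>) (s * sqrt \<tau>) * R (s / sqrt \<tau>) (t / sqrt \<tau>))
      * (of_real t powr (- (\<i> * of_real (2 * pi * \<theta>)) - 1)
         * cnj (of_real s powr (- (\<i> * of_real (2 * pi * \<theta>)) - 1))))) = A * cnj A + B"
proof -
  define G where "G = (\<lambda>(t, s). g t * cnj (g s) + (\<Sum>i. f i (t, s)))"
  note P = haar_pair_product[OF g_integral(1) integrable_cnj[OF g_integral(1)]]
  have gi: "(\<integral>t. cnj (g t) \<partial>haar) = cnj A" using g_integral(2) by simp
  have G: "G = (\<lambda>x. (case x of (t, s) \<Rightarrow> g t * cnj (g s)) + (\<Sum>i. f i x))" by (auto simp: G_def)
  have IG: "integrable (haar \<Otimes>\<^sub>M haar) G" "integral\<^sup>L (haar \<Otimes>\<^sub>M haar) G = A * cnj A + B"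
    unfolding G using P(1,2) F_integral by (simp_all add: g_integral gi)
  have Gmeas [measurable]: "G \<in> borel_measurable (haar \<Otimes>\<^sub>M haar)" using IG(1) by (rule borel_measurable_integrable)
  have Gm: "(\<lambda>s. G (t, s)) \<in> borel_measurable borel" for t
    using measurable_compose[OF measurable_Pair1' Gmeas, of t] by (simp cong: measurable_cong_sets)
  have Gm': "(\<lambda>t. \<integral>s. G (t, s) \<partial>haar) \<in> borel_measurable borel"
  proof -
    have "(\<lambda>t. \<integral>s. G (t, s) \<partial>haar) \<in> borel_measurable haar" by measurable
    then show ?thesis by (simp cong: measurable_cong_sets)
  qed
  have "A * cnj A + B = (\<integral>t. (\<integral>s. G (t, s) \<partial>haar) \<partial>haar)"
    using haar_pair.integral_fst'[OF IG(1)] IG(2) by simp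
  also have "\<dots> = (LINT t:{0<..}|lborel. (LINT s:{0<..}|lborel. G (t, s) /\<^sub>R s) /\<^sub>R t)"
    unfolding integral_haar_eq[OF Gm'] unfolding integral_haar_eq[OF Gm] ..
  \<comment> \<open>The outer density 1/t moves under the inner integral, where it completes the
    kernel at t.\<close>
  also have "\<dots> = (LINT t:{0<..}|lborel. (LINT s:{0<..}|lborel. G (t, s) /\<^sub>R s /\<^sub>R t))"
    by (simp only: set_integral_scaleR_right)
  also have "\<dots> = (LINT t:{0<..}|lborel. (LINT s:{0<..}|lborel.
      (R (t * sqrt \<tau>) (t / sqrt \<tau>) * cnj (R (s * sqrt \<tau>) (s / sqrt \<tau>))
        + R (t * sqrt \<tau>) (s * sqrt \<tau>) * R (s / sqrt \<tau>) (t / sqrt \<tau>))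
      * (of_real t powr (- (\<i> * of_real (2 * pi * \<theta>)) - 1)
         * cnj (of_real s powr (- (\<i> * of_real (2 * pi * \<theta>)) - 1)))))"
  proof (intro set_lebesgue_integral_cong allI impI)
    fix t s :: real assume "t \<in> {0<..}" "s \<in> {0<..}"
    then have t: "t > 0" and s: "s > 0" by auto
    show "G (t, s) /\<^sub>R s /\<^sub>R t = (R (t * sqrt \<tau>) (t / sqrt \<tau>) * cnj (R (s * sqrt \<tau>) (s / sqrt \<tau>))
        + R (t * sqrt \<tau>) (s * sqrt \<tau>) * R (s / sqrt \<tau>) (t / sqrt \<tau>))
      * (of_real t powr (- (\<i> * of_real (2 * pi * \<theta>)) - 1)
         * cnj (of_real s powr (- (\<i> * of_real (2 * pi * \<theta>)) - 1)))"
      unfolding powr_eq_mchar[OF t] powr_eq_mchar[OF s] G_def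
      using t s by (simp add: f_pointwise g_eq mchar_divide scaleR_conv_of_real algebra_simps)
  qed simp_all
  finally show ?thesis ..
qed

end

section \<open>Assembly of the optimal kernel\<close>

theorem mainTheorem5:
  fixes M :: "'w measure"
    and X :: "real \<Rightarrow> 'w \<Rightarrow> complex"
    and Q C :: "nat \<Rightarrow> real \<Rightarrow> complex"
  assumes "prob_space M"
    and "gaussian_process M X"
    and "circularly_symmetric M X"
    and "multicomponent_lss M X Q C"
    and ms_exists: "\<And>\<theta> \<tau>. \<tau> > 0 \<Longrightarrow> ms_integrable M (amb_integrand X \<theta> \<tau>)"
    and interchange_mean: "\<And>\<theta> \<tau>. \<tau> > 0 \<Longrightarrow>
          expected_ambiguity M X \<theta> \<tau> =
          (LINT t:{0<..}|lborel. (\<integral>w. amb_integrand X \<theta> \<tau> t w \<partial>M))"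
    and interchange_power: "\<And>\<theta> \<tau>. \<tau> > 0 \<Longrightarrow>
          complex_of_real (ambiguity_power M X \<theta> \<tau>) =
          (LINT t:{0<..}|lborel. (LINT s:{0<..}|lborel.
             (\<integral>w. amb_integrand X \<theta> \<tau> t w * cnj (amb_integrand X \<theta> \<tau> s w) \<partial>M)))"
    and abs_cov: "\<And>t s. t > 0 \<Longrightarrow> s > 0 \<Longrightarrow>
          summable (\<lambda>j. cmod (Q j (sqrt (t * s)) * C j (t / s)))"
    and abs_mellin_Q: "\<And>j \<theta>. mellin_integrable (Q j) (\<i> * of_real (2 * pi * \<theta>))"
    and abs_mellin_C: "\<And>j k \<theta>.
          mellin_integrable (\<lambda>v. C j v * cnj (C k v)) (\<i> * of_real (2 * pi * \<theta>))"
    and abs_mconv: "\<And>j k \<tau>. \<tau> > 0 \<Longrightarrow> mconv_integrable (Q j) (\<lambda>u. cnj (Q k u)) \<tau>"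
    and abs_single: "\<And>\<theta> \<tau>. \<tau> > 0 \<Longrightarrow>
          summable (\<lambda>j. cmod (C j \<tau>) * mellin_abs (Q j) (\<i> * of_real (2 * pi * \<theta>)))"
    and abs_double: "\<And>\<theta> \<tau>. \<tau> > 0 \<Longrightarrow>
          (\<lambda>(j, k). mellin_abs (\<lambda>v. C j v * cnj (C k v)) (\<i> * of_real (2 * pi * \<theta>))
                     * mconv_abs (Q j) (\<lambda>u. cnj (Q k u)) \<tau>) summable_on UNIV"
  shows "\<forall>\<theta> \<tau>. \<tau> > 0 \<and> ambiguity_power M X \<theta> \<tau> > 0 \<longrightarrow>
    complex_of_real (optimal_kernel M X \<theta> \<tau>) =
      of_real ((cmod (\<Sum>j. C j \<tau> * mellin (Q j) (\<i> * of_real (2 * pi * \<theta>))))\<^sup>2) /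
      (of_real ((cmod (\<Sum>j. C j \<tau> * mellin (Q j) (\<i> * of_real (2 * pi * \<theta>))))\<^sup>2) +
       (\<Sum>\<^sub>\<infinity>(j, k)\<in>UNIV. mellin (\<lambda>v. C j v * cnj (C k v)) (\<i> * of_real (2 * pi * \<theta>))
                          * mconv (Q j) (\<lambda>u. cnj (Q k u)) \<tau>))"
proof (intro allI impI, elim conjE)
  fix \<theta> \<tau> :: real
  assume tau: "\<tau> > 0" and pos: "ambiguity_power M X \<theta> \<tau> > 0"
  have so: "second_order_process M X" and lss: "\<And>j. lss_covariance (Q j) (C j)"
    and cov: "\<And>t s. t > 0 \<Longrightarrow> s > 0 \<Longrightarrow> (\<lambda>j. Q j (sqrt (t * s)) * C j (t / s)) sums cov_fun M X t s"
    using assms(4) by (auto simp: multicomponent_lss_def)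
  interpret lss_family Q C \<theta> \<tau>
    by unfold_locales
      (fact tau lss_covariance_properties[OF lss] abs_cov abs_mellin_Q abs_mellin_C
        abs_mconv[OF tau] abs_single[OF tau] abs_double[OF tau]
      | use lss_covariance_properties[OF lss] in blast)+
  have R: "cov_fun M X t s = R t s" if "t > 0" "s > 0" for t s
    using cov[OF that] by (simp add: R_def sums_iff)
  have herm: "cov_fun M X s t = cnj (cov_fun M X t s)" for t s
    unfolding cov_fun_def Bochner_Integration.integral_cnj[symmetric] by (simp add: mult.commute)
  let ?p = "\<lambda>t :: real. of_real t powr (- (\<i> * of_real (2 * pi * \<theta>)) - 1) :: complex"
  have mean: "expected_ambiguity M X \<theta> \<tau> = A"
  proof -
    have "(\<integral>w. amb_integrand X \<theta> \<tau> t w \<partial>M) = R (t * sqrt \<tau>) (t / sqrt \<tau>) * ?p t" if "t > 0" for t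
      using that tau by (simp add: amb_integrand_def cov_fun_def flip: R)
    then show ?thesis
      unfolding interchange_mean[OF tau] mean_integral[symmetric]
      by (intro set_lebesgue_integral_cong) auto
  qed
  have pw: "complex_of_real (ambiguity_power M X \<theta> \<tau>) = A * cnj A + B"
  proof -
    have "(\<integral>w. amb_integrand X \<theta> \<tau> t w * cnj (amb_integrand X \<theta> \<tau> s w) \<partial>M)
      = (R (t * sqrt \<tau>) (t / sqrt \<tau>) * cnj (R (s * sqrt \<tau>) (s / sqrt \<tau>))
        + R (t * sqrt \<tau>) (s * sqrt \<tau>) * R (s / sqrt \<tau>) (t / sqrt \<tau>)) * (?p t * cnj (?p s))"
      if t: "t > 0" and s: "s > 0" for t s
    proof -
      \<comment> \<open>Conjugating the integrand at s exchanges the roles of its two times, so s /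
        sqrt(\<tau>) becomes the plain and s sqrt(\<tau>) the conjugated one. The positivity facts
        are listed in the resulting order for Isserlis' formula.\<close>
      have p: "t * sqrt \<tau> > 0" "t / sqrt \<tau> > 0" "s / sqrt \<tau> > 0" "s * sqrt \<tau> > 0" using t s tau by auto
      have "(\<integral>w. amb_integrand X \<theta> \<tau> t w * cnj (amb_integrand X \<theta> \<tau> s w) \<partial>M)
        = (\<integral>w. X (t * sqrt \<tau>) w * cnj (X (t / sqrt \<tau>) w) * (X (s / sqrt \<tau>) w * cnj (X (s * sqrt \<tau>) w))
            * (?p t * cnj (?p s)) \<partial>M)"
        by (intro Bochner_Integration.integral_cong refl) (simp add: amb_integrand_def mult_ac)
      also have "\<dots> = (\<integral>w. X (t * sqrt \<tau>) w * cnj (X (t / sqrt \<tau>) w) * (X (s / sqrt \<tau>) w * cnj (X (s * sqrt \<tau>) w)) \<partial>M)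
            * (?p t * cnj (?p s))"
        by (rule integral_mult_left_zero)
      finally show ?thesis
        \<comment> \<open>Hermitian symmetry rewrites the covariance at (s / sqrt(\<tau>), s
          sqrt(\<tau>)) as the conjugate of the mean integrand at s.\<close>
        unfolding circular_gaussian_process_isserlis[OF assms(1,3) so assms(2) p]
        using p by (simp only: R herm[of "s / sqrt \<tau>" "s * sqrt \<tau>"])
    qed
    then show ?thesis
      unfolding interchange_power[OF tau] power_integral[symmetric]
      by (intro set_lebesgue_integral_cong allI impI) auto
  qed
  have AA: "A * cnj A = of_real ((cmod A)\<^sup>2)" by (rule complex_norm_square[symmetric])
  \<comment> \<open>Positivity selects the quotient branch of \<open>optimal_kernel\<close>; by
    \<open>pw\<close> the complex denominator equals that positive real power.\<close>
  have "complex_of_real (optimal_kernel M X \<theta> \<tau>)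
      = of_real ((cmod A)\<^sup>2) / complex_of_real (ambiguity_power M X \<theta> \<tau>)"
    using pos by (simp add: optimal_kernel_def mean)
  also have "\<dots> = of_real ((cmod A)\<^sup>2) / (of_real ((cmod A)\<^sup>2) + B)" unfolding pw AA ..
  finally show "complex_of_real (optimal_kernel M X \<theta> \<tau>) =
      of_real ((cmod (\<Sum>j. C j \<tau> * mellin (Q j) (\<i> * of_real (2 * pi * \<theta>))))\<^sup>2) /
      (of_real ((cmod (\<Sum>j. C j \<tau> * mellin (Q j) (\<i> * of_real (2 * pi * \<theta>))))\<^sup>2) +
       (\<Sum>\<^sub>\<infinity>(j, k)\<in>UNIV. mellin (\<lambda>v. C j v * cnj (C k v)) (\<i> * of_real (2 * pi * \<theta>))
                          * mconv (Q j) (\<lambda>u. cnj (Q k u)) \<tau>))"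
    unfolding A_def B_def .
qed

end
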